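(* The category $\mathbf{DCA}$ of all dynamic contact algebras with DCA-morphisms is dually equivalent to the category $\mathbf{DMS}^*$ of all $T_0$ and DM-compact dynamic mereotopological spaces with DMS-morphisms.
   Context: DCA: $(B,C^s,C^t,\mathcal{B})$ with $B$ a Boolean algebra, $0\neq1$, $C^s,C^t$ contact relations, $\mathcal{B}$ a precontact relation (precontact: $aCb\Rightarrow a,b\neq0$; upward monotone; $aC(b+c)\Rightarrow aCb\vee aCc$; $(a+b)Cc\Rightarrow aCc\vee bCc$; contact: also symmetric and $a\cdot b\neq0\Rightarrow aCb$), with $aC^sb\Rightarrow aC^tb$; $a\overline{C^t}b\Rightarrow\exists c(a\overline{C^t}c\wedge c^*\overline{C^t}b)$; $a\overline{\mathcal{B}}b\Rightarrow\exists c(a\overline{C^t}c\wedge c^*\overline{\mathcal{B}}b)$; $a\overline{\mathcal{B}}b\Rightarrow\exists c(a\overline{\mathcal{B}}c\wedge c^*\overline{C^t}b)$. A DCA-morphism $f:A_1\to A_2$ is a Boolean homomorphism $B_1\to B_2$ such that $f(a)C^sf(b)\Rightarrow aC^sb$, $f(a)C^tf(b)\Rightarrow aC^tb$, $f(a)\mathcal{B}f(b)\Rightarrow a\mathcal{B}b$. A DMS is $S=(X^t,X^s,T,\prec,M)$: $X^t$ a nonempty topological space; $M$ a Boolean subalgebra of the regular closed sets $RC(X^t)$ ($a+b=a\cup b$, $a\cdot b=Cl\,Int(a\cap b)$, $a^*=Cl(X^t\setminus a)$) forming a closed base of the topology; $X^s,T$ nonempty subsets of $X^t$; every nonempty regular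 closed set meets $X^s$; $\prec$ a binary relation on $X^t$; with $aC^tb$ iff $a\cap b\neq\emptyset$, $aC^sb$ iff $a\cap b\cap X^s\neq\emptyset$, $a\mathcal{B}b$ iff $\exists x\in a,y\in b\,(x\prec y)$, $S^+=(M,C^s,C^t,\mathcal{B})$, $\rho_S(x)=\{a\in M:x\in a\}$, required: $S^+$ is a DCA; $x\prec y$ iff $\forall a,b\in M(x\in a,y\in b\Rightarrow a\mathcal{B}b)$; $\rho_S(x)$ is a cluster of $S^+$ for $x\in T$. For a DCA, t-clans (s-clans) are $\Gamma\subseteq B$ with $1\in\Gamma,0\notin\Gamma$, upward closed, $a+b\in\Gamma\Rightarrow a\in\Gamma\vee b\in\Gamma$, pairwise $C^t$- (resp. $C^s$-) related; clusters: t-clans with $\forall a\notin\Gamma\exists b\in\Gamma\,a\overline{C^t}b$. $S$ is $T_0$ if $X^t$ is $T_0$; DM-compact if every t-clan, s-clan, cluster of $S^+$ equals $\rho_S(x)$ for some $x$ in $X^t$, $X^s$, $T$ respectively. A DMS-morphism $\theta:S_1\to S_2$ is a map $X^t_1\to X^t_2$ with $\theta(X^s_1)\subseteq X^s_2$, $x\prec_1y\Rightarrow\theta(x)\prec_2\theta(y)$, $\theta^{-1}(a)\in M_1$ for all $a\in M_2$, and $\theta^{-1}:M_2\to M_1$ a Boolean homomorphism. *)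

theory Defs
  imports "HOL-Analysis.Analysis"
begin

section \<open>Categories and dual equivalence\<close>

text \<open>
  Categories are presented by hom-sets. Hom-sets of different pairs of objects need not be
  disjoint, so composition is indexed by the objects involved:
  \<open>Comp C x y z g f\<close> is \<open>g \<circ> f\<close> for \<open>f : x \<rightarrow> y\<close> and \<open>g : y \<rightarrow> z\<close>.
\<close>

record ('o, 'm) category =
  Obj :: "'o set"
  Hom :: "'o \<Rightarrow> 'o \<Rightarrow> 'm set"
  Id :: "'o \<Rightarrow> 'm"
  Comp :: "'o \<Rightarrow> 'o \<Rightarrow> 'o \<Rightarrow> 'm \<Rightarrow> 'm \<Rightarrow> 'm"

definition is_category :: "('o, 'm) category \<Rightarrow> bool" where
  "is_category C \<longleftrightarrow>
     (\<forall>x\<in>Obj C. Id C x \<in> Hom C x x) \<and>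
     (\<forall>x\<in>Obj C. \<forall>y\<in>Obj C. \<forall>z\<in>Obj C. \<forall>f\<in>Hom C x y. \<forall>g\<in>Hom C y z.
        Comp C x y z g f \<in> Hom C x z) \<and>
     (\<forall>x\<in>Obj C. \<forall>y\<in>Obj C. \<forall>f\<in>Hom C x y.
        Comp C x x y f (Id C x) = f \<and> Comp C x y y (Id C y) f = f) \<and>
     (\<forall>w\<in>Obj C. \<forall>x\<in>Obj C. \<forall>y\<in>Obj C. \<forall>z\<in>Obj C.
        \<forall>f\<in>Hom C w x. \<forall>g\<in>Hom C x y. \<forall>h\<in>Hom C y z.
          Comp C w y z h (Comp C w x y g f) = Comp C w x z (Comp C x y z h g) f)"

definition opposite :: "('o, 'm) category \<Rightarrow> ('o, 'm) category" where
  "opposite C = \<lparr>Obj = Obj C, Hom = (\<lambda>x y. Hom C y x), Id = Id C,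
                 Comp = (\<lambda>x y z g f. Comp C z y x f g)\<rparr>"

definition is_iso :: "('o, 'm) category \<Rightarrow> 'o \<Rightarrow> 'o \<Rightarrow> 'm \<Rightarrow> bool" where
  "is_iso C x y f \<longleftrightarrow> f \<in> Hom C x y \<and>
     (\<exists>g\<in>Hom C y x. Comp C x y x g f = Id C x \<and> Comp C y x y f g = Id C y)"

record ('o, 'm, 'p, 'n) functor_data =
  FObj :: "'o \<Rightarrow> 'p"
  FHom :: "'o \<Rightarrow> 'o \<Rightarrow> 'm \<Rightarrow> 'n"

definition is_functor ::
  "('o, 'm) category \<Rightarrow> ('p, 'n) category \<Rightarrow> ('o, 'm, 'p, 'n) functor_data \<Rightarrow> bool" where
  "is_functor C D F \<longleftrightarrow>
     (\<forall>x\<in>Obj C. FObj F x \<in> Obj D) \<and>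
     (\<forall>x\<in>Obj C. \<forall>y\<in>Obj C. \<forall>f\<in>Hom C x y. FHom F x y f \<in> Hom D (FObj F x) (FObj F y)) \<and>
     (\<forall>x\<in>Obj C. FHom F x x (Id C x) = Id D (FObj F x)) \<and>
     (\<forall>x\<in>Obj C. \<forall>y\<in>Obj C. \<forall>z\<in>Obj C. \<forall>f\<in>Hom C x y. \<forall>g\<in>Hom C y z.
        FHom F x z (Comp C x y z g f) =
          Comp D (FObj F x) (FObj F y) (FObj F z) (FHom F y z g) (FHom F x y f))"

definition id_functor :: "('o, 'm, 'o, 'm) functor_data" where
  "id_functor = \<lparr>FObj = (\<lambda>x. x), FHom = (\<lambda>x y f. f)\<rparr>"

definition comp_functor ::
  "('p, 'n, 'q, 'l) functor_data \<Rightarrow> ('o, 'm, 'p, 'n) functor_data \<Rightarrow> ('o, 'm, 'q, 'l) functor_data"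
  where
  "comp_functor G F =
     \<lparr>FObj = (\<lambda>x. FObj G (FObj F x)),
      FHom = (\<lambda>x y f. FHom G (FObj F x) (FObj F y) (FHom F x y f))\<rparr>"

definition natural_iso ::
  "('o, 'm) category \<Rightarrow> ('p, 'n) category \<Rightarrow> ('o, 'm, 'p, 'n) functor_data \<Rightarrow>
   ('o, 'm, 'p, 'n) functor_data \<Rightarrow> ('o \<Rightarrow> 'n) \<Rightarrow> bool" where
  "natural_iso C D F G \<eta> \<longleftrightarrow>
     (\<forall>x\<in>Obj C. is_iso D (FObj F x) (FObj G x) (\<eta> x)) \<and>
     (\<forall>x\<in>Obj C. \<forall>y\<in>Obj C. \<forall>f\<in>Hom C x y.
        Comp D (FObj F x) (FObj F y) (FObj G y) (\<eta> y) (FHom F x y f) =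
        Comp D (FObj F x) (FObj G x) (FObj G y) (FHom G x y f) (\<eta> x))"

definition equivalent_categories :: "('o, 'm) category \<Rightarrow> ('p, 'n) category \<Rightarrow> bool" where
  "equivalent_categories C D \<longleftrightarrow> is_category C \<and> is_category D \<and>
     (\<exists>F G \<eta> \<epsilon>. is_functor C D F \<and> is_functor D C G \<and>
        natural_iso C C id_functor (comp_functor G F) \<eta> \<and>
        natural_iso D D (comp_functor F G) id_functor \<epsilon>)"

definition dually_equivalent :: "('o, 'm) category \<Rightarrow> ('p, 'n) category \<Rightarrow> bool" where
  "dually_equivalent C D \<longleftrightarrow> equivalent_categories (opposite C) D"


section \<open>Boolean algebras on a carrier\<close>

record 'a bool_alg =
  carr :: "'a set"
  zer :: 'a
  one :: 'a
  join :: "'a \<Rightarrow> 'a \<Rightarrow> 'a"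
  meet :: "'a \<Rightarrow> 'a \<Rightarrow> 'a"
  cmpl :: "'a \<Rightarrow> 'a"

text \<open>The axioms of \<^locale>\<open>abstract_boolean_algebra\<close>, relativised to the carrier.\<close>

definition is_bool_alg :: "('a, 'z) bool_alg_scheme \<Rightarrow> bool" where
  "is_bool_alg A \<longleftrightarrow>
     zer A \<in> carr A \<and> one A \<in> carr A \<and>
     (\<forall>a\<in>carr A. cmpl A a \<in> carr A) \<and>
     (\<forall>a\<in>carr A. \<forall>b\<in>carr A. join A a b \<in> carr A \<and> meet A a b \<in> carr A) \<and>
     (\<forall>a\<in>carr A. \<forall>b\<in>carr A. join A a b = join A b a \<and> meet A a b = meet A b a) \<and>
     (\<forall>a\<in>carr A. \<forall>b\<in>carr A. \<forall>c\<in>carr A.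
        join A (join A a b) c = join A a (join A b c) \<and>
        meet A (meet A a b) c = meet A a (meet A b c) \<and>
        meet A a (join A b c) = join A (meet A a b) (meet A a c) \<and>
        join A a (meet A b c) = meet A (join A a b) (join A a c)) \<and>
     (\<forall>a\<in>carr A. join A a (zer A) = a \<and> meet A a (one A) = a \<and>
        join A a (cmpl A a) = one A \<and> meet A a (cmpl A a) = zer A)"

definition ble :: "('a, 'z) bool_alg_scheme \<Rightarrow> 'a \<Rightarrow> 'a \<Rightarrow> bool" where
  "ble A a b \<longleftrightarrow> meet A a b = a"

definition bool_hom ::
  "('a, 'z) bool_alg_scheme \<Rightarrow> ('b, 'w) bool_alg_scheme \<Rightarrow> ('a \<Rightarrow> 'b) \<Rightarrow> bool" where
  "bool_hom A1 A2 f \<longleftrightarrow>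
     (\<forall>a\<in>carr A1. f a \<in> carr A2) \<and>
     f (zer A1) = zer A2 \<and> f (one A1) = one A2 \<and>
     (\<forall>a\<in>carr A1. f (cmpl A1 a) = cmpl A2 (f a)) \<and>
     (\<forall>a\<in>carr A1. \<forall>b\<in>carr A1.
        f (join A1 a b) = join A2 (f a) (f b) \<and> f (meet A1 a b) = meet A2 (f a) (f b))"


section \<open>Dynamic contact algebras\<close>

definition precontact :: "('a, 'z) bool_alg_scheme \<Rightarrow> ('a \<Rightarrow> 'a \<Rightarrow> bool) \<Rightarrow> bool" where
  "precontact A C \<longleftrightarrow>
     (\<forall>a\<in>carr A. \<forall>b\<in>carr A. C a b \<longrightarrow> a \<noteq> zer A \<and> b \<noteq> zer A) \<and>
     (\<forall>a\<in>carr A. \<forall>b\<in>carr A. \<forall>a'\<in>carr A. \<forall>b'\<in>carr A.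
        C a b \<and> ble A a a' \<and> ble A b b' \<longrightarrow> C a' b') \<and>
     (\<forall>a\<in>carr A. \<forall>b\<in>carr A. \<forall>c\<in>carr A. C a (join A b c) \<longrightarrow> C a b \<or> C a c) \<and>
     (\<forall>a\<in>carr A. \<forall>b\<in>carr A. \<forall>c\<in>carr A. C (join A a b) c \<longrightarrow> C a c \<or> C b c)"

definition contact :: "('a, 'z) bool_alg_scheme \<Rightarrow> ('a \<Rightarrow> 'a \<Rightarrow> bool) \<Rightarrow> bool" where
  "contact A C \<longleftrightarrow> precontact A C \<and>
     (\<forall>a\<in>carr A. \<forall>b\<in>carr A. C a b \<longrightarrow> C b a) \<and>
     (\<forall>a\<in>carr A. \<forall>b\<in>carr A. meet A a b \<noteq> zer A \<longrightarrow> C a b)"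

text \<open>\<open>Cs\<close>, \<open>Ct\<close> and \<open>Bp\<close> are \<open>C\<^sup>s\<close>, \<open>C\<^sup>t\<close> and the precontact relation \<open>\<B>\<close>.\<close>

record 'a dca = "'a bool_alg" +
  Cs :: "'a \<Rightarrow> 'a \<Rightarrow> bool"
  Ct :: "'a \<Rightarrow> 'a \<Rightarrow> bool"
  Bp :: "'a \<Rightarrow> 'a \<Rightarrow> bool"

definition is_dca :: "'a dca \<Rightarrow> bool" where
  "is_dca A \<longleftrightarrow>
     is_bool_alg A \<and> zer A \<noteq> one A \<and>
     contact A (Cs A) \<and> contact A (Ct A) \<and> precontact A (Bp A) \<and>
     (\<forall>a\<in>carr A. \<forall>b\<in>carr A. Cs A a b \<longrightarrow> Ct A a b) \<and>
     (\<forall>a\<in>carr A. \<forall>b\<in>carr A. \<not> Ct A a b \<longrightarrow>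
        (\<exists>c\<in>carr A. \<not> Ct A a c \<and> \<not> Ct A (cmpl A c) b)) \<and>
     (\<forall>a\<in>carr A. \<forall>b\<in>carr A. \<not> Bp A a b \<longrightarrow>
        (\<exists>c\<in>carr A. \<not> Ct A a c \<and> \<not> Bp A (cmpl A c) b)) \<and>
     (\<forall>a\<in>carr A. \<forall>b\<in>carr A. \<not> Bp A a b \<longrightarrow>
        (\<exists>c\<in>carr A. \<not> Bp A a c \<and> \<not> Ct A (cmpl A c) b))"

definition dca_morphism :: "'a dca \<Rightarrow> 'b dca \<Rightarrow> ('a \<Rightarrow> 'b) \<Rightarrow> bool" where
  "dca_morphism A1 A2 f \<longleftrightarrow> bool_hom A1 A2 f \<and>
     (\<forall>a\<in>carr A1. \<forall>b\<in>carr A1.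
        (Cs A2 (f a) (f b) \<longrightarrow> Cs A1 a b) \<and>
        (Ct A2 (f a) (f b) \<longrightarrow> Ct A1 a b) \<and>
        (Bp A2 (f a) (f b) \<longrightarrow> Bp A1 a b))"

definition clan :: "('a, 'z) bool_alg_scheme \<Rightarrow> ('a \<Rightarrow> 'a \<Rightarrow> bool) \<Rightarrow> 'a set \<Rightarrow> bool" where
  "clan A C \<Gamma> \<longleftrightarrow> \<Gamma> \<subseteq> carr A \<and> one A \<in> \<Gamma> \<and> zer A \<notin> \<Gamma> \<and>
     (\<forall>a\<in>\<Gamma>. \<forall>b\<in>carr A. ble A a b \<longrightarrow> b \<in> \<Gamma>) \<and>
     (\<forall>a\<in>carr A. \<forall>b\<in>carr A. join A a b \<in> \<Gamma> \<longrightarrow> a \<in> \<Gamma> \<or> b \<in> \<Gamma>) \<and>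
     (\<forall>a\<in>\<Gamma>. \<forall>b\<in>\<Gamma>. C a b)"

definition t_clan :: "'a dca \<Rightarrow> 'a set \<Rightarrow> bool" where
  "t_clan A \<Gamma> \<longleftrightarrow> clan A (Ct A) \<Gamma>"

definition s_clan :: "'a dca \<Rightarrow> 'a set \<Rightarrow> bool" where
  "s_clan A \<Gamma> \<longleftrightarrow> clan A (Cs A) \<Gamma>"

definition cluster :: "'a dca \<Rightarrow> 'a set \<Rightarrow> bool" where
  "cluster A \<Gamma> \<longleftrightarrow> t_clan A \<Gamma> \<and> (\<forall>a\<in>carr A. a \<notin> \<Gamma> \<longrightarrow> (\<exists>b\<in>\<Gamma>. \<not> Ct A a b))"


section \<open>Dynamic mereotopological spaces\<close>

text \<open>
  A structure \<open>(X\<^sup>t, X\<^sup>s, T, \<prec>, M)\<close>; the underlying set of \<open>X\<^sup>t\<close> is the \<^const>\<open>topspace\<close> of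
  the topology \<open>Xt\<close>.
\<close>

record 'x dms =
  Xt :: "'x topology"
  Xs :: "'x set"
  TT :: "'x set"
  prec :: "'x \<Rightarrow> 'x \<Rightarrow> bool"
  MM :: "'x set set"

definition regular_closed_sets :: "'x topology \<Rightarrow> 'x set set" where
  "regular_closed_sets X = {a. a \<subseteq> topspace X \<and> X closure_of (X interior_of a) = a}"

definition rc_meet :: "'x topology \<Rightarrow> 'x set \<Rightarrow> 'x set \<Rightarrow> 'x set" where
  "rc_meet X a b = X closure_of (X interior_of (a \<inter> b))"

definition rc_cmpl :: "'x topology \<Rightarrow> 'x set \<Rightarrow> 'x set" where
  "rc_cmpl X a = X closure_of (topspace X - a)"

definition rc_subalgebra :: "'x topology \<Rightarrow> 'x set set \<Rightarrow> bool" where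
  "rc_subalgebra X M \<longleftrightarrow> M \<subseteq> regular_closed_sets X \<and> {} \<in> M \<and> topspace X \<in> M \<and>
     (\<forall>a\<in>M. rc_cmpl X a \<in> M) \<and> (\<forall>a\<in>M. \<forall>b\<in>M. a \<union> b \<in> M \<and> rc_meet X a b \<in> M)"

definition closed_base :: "'x topology \<Rightarrow> 'x set set \<Rightarrow> bool" where
  "closed_base X M \<longleftrightarrow> (\<forall>a\<in>M. closedin X a) \<and>
     (\<forall>C. closedin X C \<longrightarrow> (\<exists>F\<subseteq>M. C = topspace X \<inter> \<Inter>F))"

definition dms_plus :: "'x dms \<Rightarrow> 'x set dca" where
  "dms_plus S =
     \<lparr>carr = MM S, zer = {}, one = topspace (Xt S), join = (\<union>),
      meet = rc_meet (Xt S), cmpl = rc_cmpl (Xt S),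
      Cs = (\<lambda>a b. a \<inter> b \<inter> Xs S \<noteq> {}),
      Ct = (\<lambda>a b. a \<inter> b \<noteq> {}),
      Bp = (\<lambda>a b. \<exists>x\<in>a. \<exists>y\<in>b. prec S x y)\<rparr>"

definition rho :: "'x dms \<Rightarrow> 'x \<Rightarrow> 'x set set" where
  "rho S x = {a \<in> MM S. x \<in> a}"

definition is_dms :: "'x dms \<Rightarrow> bool" where
  "is_dms S \<longleftrightarrow>
     topspace (Xt S) \<noteq> {} \<and>
     rc_subalgebra (Xt S) (MM S) \<and> closed_base (Xt S) (MM S) \<and>
     Xs S \<noteq> {} \<and> Xs S \<subseteq> topspace (Xt S) \<and>
     TT S \<noteq> {} \<and> TT S \<subseteq> topspace (Xt S) \<and>
     (\<forall>a\<in>regular_closed_sets (Xt S). a \<noteq> {} \<longrightarrow> a \<inter> Xs S \<noteq> {}) \<and>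
     is_dca (dms_plus S) \<and>
     (\<forall>x\<in>topspace (Xt S). \<forall>y\<in>topspace (Xt S).
        prec S x y \<longleftrightarrow> (\<forall>a\<in>MM S. \<forall>b\<in>MM S. x \<in> a \<and> y \<in> b \<longrightarrow> Bp (dms_plus S) a b)) \<and>
     (\<forall>x\<in>TT S. cluster (dms_plus S) (rho S x))"

definition dm_compact :: "'x dms \<Rightarrow> bool" where
  "dm_compact S \<longleftrightarrow>
     (\<forall>\<Gamma>. t_clan (dms_plus S) \<Gamma> \<longrightarrow> (\<exists>x\<in>topspace (Xt S). \<Gamma> = rho S x)) \<and>
     (\<forall>\<Gamma>. s_clan (dms_plus S) \<Gamma> \<longrightarrow> (\<exists>x\<in>Xs S. \<Gamma> = rho S x)) \<and>
     (\<forall>\<Gamma>. cluster (dms_plus S) \<Gamma> \<longrightarrow> (\<exists>x\<in>TT S. \<Gamma> = rho S x))"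

definition dms_preimage :: "'x dms \<Rightarrow> ('x \<Rightarrow> 'y) \<Rightarrow> 'y set \<Rightarrow> 'x set" where
  "dms_preimage S1 \<theta> a = \<theta> -` a \<inter> topspace (Xt S1)"

definition dms_morphism :: "'x dms \<Rightarrow> 'y dms \<Rightarrow> ('x \<Rightarrow> 'y) \<Rightarrow> bool" where
  "dms_morphism S1 S2 \<theta> \<longleftrightarrow>
     \<theta> \<in> topspace (Xt S1) \<rightarrow> topspace (Xt S2) \<and>
     \<theta> ` Xs S1 \<subseteq> Xs S2 \<and>
     (\<forall>x\<in>topspace (Xt S1). \<forall>y\<in>topspace (Xt S1). prec S1 x y \<longrightarrow> prec S2 (\<theta> x) (\<theta> y)) \<and>
     (\<forall>a\<in>MM S2. dms_preimage S1 \<theta> a \<in> MM S1) \<and>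
     bool_hom (dms_plus S2) (dms_plus S1) (dms_preimage S1 \<theta>)"


section \<open>The two categories\<close>

text \<open>
  There is no HOL type of all sets, so both categories are formed at a size: an object is small if
  its algebra (the carrier, respectively \<open>M\<close>) has cardinality strictly below that of \<open>K\<close>, where
  \<open>K\<close> is an arbitrary set.

  On the topological side the bound is put on \<open>M\<close>, which is the carrier of the dual algebra. It also
  bounds the points: in a T0 space a point \<open>x\<close> is determined by \<open>rho S x \<subseteq> M\<close>. If the
  cardinality of \<open>K\<close> is a strong limit, \<open>MM S \<prec> K\<close> amounts to \<open>topspace (Xt S) \<prec> K\<close>.
  If it is the successor of the cardinality of a type \<open>'a\<close>, the objects of \<open>DCA_cat K\<close> over \<open>'a\<close>
  are all dynamic contact algebras with carrier in \<open>'a\<close>.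

  Morphisms are maps restricted to the underlying set of the source, so that equality of morphisms
  is equality of functions.
\<close>

definition DCA_cat :: "'k set \<Rightarrow> ('a dca, 'a \<Rightarrow> 'a) category" where
  "DCA_cat K =
     \<lparr>Obj = {A. is_dca A \<and> carr A \<prec> K},
      Hom = (\<lambda>A1 A2. {f \<in> extensional (carr A1). dca_morphism A1 A2 f}),
      Id = (\<lambda>A. restrict id (carr A)),
      Comp = (\<lambda>A1 A2 A3 g f. compose (carr A1) g f)\<rparr>"

definition DMS_star_cat :: "'k set \<Rightarrow> ('x dms, 'x \<Rightarrow> 'x) category" where
  "DMS_star_cat K =
     \<lparr>Obj = {S. is_dms S \<and> t0_space (Xt S) \<and> dm_compact S \<and> MM S \<prec> K},
      Hom = (\<lambda>S1 S2. {\<theta> \<in> extensional (topspace (Xt S1)). dms_morphism S1 S2 \<theta>}),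
      Id = (\<lambda>S. restrict id (topspace (Xt S))),
      Comp = (\<lambda>S1 S2 S3 g f. compose (topspace (Xt S1)) g f)\<rparr>"

text \<open>
  The types \<open>'a\<close> and \<open>'x\<close> supplying the elements of algebras and the points of spaces have room for
  the small objects and their duals, whose points are sets of elements of the algebra. This holds
  for instance if \<open>'x = 'a set\<close> and \<open>K\<close> has the successor cardinality of \<open>'a\<close>, and also if
  \<open>'a = 'x\<close> and \<open>K = UNIV\<close> is a universe of strong limit cardinality.
\<close>

definition size_admissible :: "'k set \<Rightarrow> 'a itself \<Rightarrow> 'x itself \<Rightarrow> bool" where
  "size_admissible K a x \<longleftrightarrow>
     (\<forall>I::'k set. I \<prec> K \<longrightarrow> I \<lesssim> (UNIV::'a set) \<and> Pow I \<lesssim> (UNIV::'x set))"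

end

theory Submission
  imports Defs
begin

text \<open>
  Sending a space \<open>S\<close> to a copy of \<open>S\<^sup>+\<close> inside the type of algebra elements, and a morphism
  \<open>\<theta>\<close> to \<open>\<theta>\<^sup>-\<^sup>1\<close>, is a contravariant functor, and it is enough that it is fully faithful and
  essentially surjective. It is faithful because in a T0 space a point \<open>x\<close> is determined by
  \<open>rho S x\<close>. It is full because, for a DCA-morphism \<open>f\<close> from \<open>S\<^sub>2\<^sup>+\<close> to \<open>S\<^sub>1\<^sup>+\<close>, the set of all \<open>a\<close> with
  \<open>x \<in> f a\<close> is a t-clan, hence of the form \<open>rho S\<^sub>2 y\<close> by DM-compactness, and \<open>x \<mapsto> y\<close> induces \<open>f\<close>.
  It is essentially surjective because the t-clans of a dynamic contact algebra \<open>A\<close> form a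
  DM-compact T0 space whose dual algebra is \<open>A\<close>; that the three relations are
  recovered rests on extending a pair of related elements to a pair of related ultrafilters.
\<close>

section \<open>A criterion for equivalence of categories\<close>

text \<open>The dual algebra of a space over \<open>'x\<close> has elements of type
  \<open>'x set\<close>, while the algebras of the category live in \<open>'a\<close>, and t-clans
  over \<open>'a\<close> have to become points in \<open>'x\<close>. Both passages are transports
  along injections, whose existence is all that \<open>size_admissible\<close> supplies; the functor
  therefore conjugates preimages with chosen isomorphisms. Points have to be clans rather than
  ultrafilters because a single point must witness contact between elements whose meet is zero. A
  clan need not be closed under meets and may contain an element together with its complement, so
  the algebra reappears as regular closed sets and not as clopen ones. The interpolation axiom for
  \<open>Ct\<close> enters through clusters: it turns the set of all elements in contact with a
  whole ultrafilter into a clan, which makes \<open>TT\<close> nonempty. A DMS-morphism is not asked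
  to respect \<open>TT\<close>. Correspondingly, t-clans and s-clans are pulled back along every
  DCA-morphism, clusters only along isomorphisms.\<close>

text \<open>Choose for every \<open>c\<close> an object \<open>F c\<close> and an isomorphism
  \<open>u c\<close> onto its image, with inverse \<open>v c\<close>. An arrow \<open>f\<close> is
  sent to the unique \<open>G\<close>-preimage of \<open>u\<close> after \<open>f\<close> after
  \<open>v\<close>. Every equation in \<open>D\<close> is checked by applying the faithful
  \<open>G\<close>; the unit is \<open>u\<close>, the counit the preimage of
  \<open>v\<close>.\<close>

lemma full_faithful_ess_surj_equivalent:
  assumes C: "is_category C" and D: "is_category D" and G: "is_functor D C G"
    and ff: "\<And>x y. \<lbrakk>x \<in> Obj D; y \<in> Obj D\<rbrakk> \<Longrightarrow>
      bij_betw (FHom G x y) (Hom D x y) (Hom C (FObj G x) (FObj G y))"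
    and es: "\<And>c. c \<in> Obj C \<Longrightarrow> \<exists>d\<in>Obj D. \<exists>u. is_iso C c (FObj G d) u"
  shows "equivalent_categories C D"
proof -
  let ?g = "FObj G" and ?G = "FHom G"
  have C_Id: "\<And>x. x \<in> Obj C \<Longrightarrow> Id C x \<in> Hom C x x"
    and C_comp: "\<And>x y z f g. \<lbrakk>x \<in> Obj C; y \<in> Obj C; z \<in> Obj C; f \<in> Hom C x y; g \<in> Hom C y z\<rbrakk>
      \<Longrightarrow> Comp C x y z g f \<in> Hom C x z"
    and C_left: "\<And>x y f. \<lbrakk>x \<in> Obj C; y \<in> Obj C; f \<in> Hom C x y\<rbrakk> \<Longrightarrow> Comp C x y y (Id C y) f = f"
    and C_right: "\<And>x y f. \<lbrakk>x \<in> Obj C; y \<in> Obj C; f \<in> Hom C x y\<rbrakk> \<Longrightarrow> Comp C x x y f (Id C x) = f"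
    and C_assoc: "\<And>w x y z f g h. \<lbrakk>w \<in> Obj C; x \<in> Obj C; y \<in> Obj C; z \<in> Obj C;
        f \<in> Hom C w x; g \<in> Hom C x y; h \<in> Hom C y z\<rbrakk>
      \<Longrightarrow> Comp C w x z (Comp C x y z h g) f = Comp C w y z h (Comp C w x y g f)"
    using C unfolding is_category_def by simp_all
  note C_simps = C_Id C_comp C_left C_right C_assoc
  have D_Id: "\<And>x. x \<in> Obj D \<Longrightarrow> Id D x \<in> Hom D x x"
    and D_comp: "\<And>x y z f g. \<lbrakk>x \<in> Obj D; y \<in> Obj D; z \<in> Obj D; f \<in> Hom D x y; g \<in> Hom D y z\<rbrakk>
      \<Longrightarrow> Comp D x y z g f \<in> Hom D x z"
    using D unfolding is_category_def by simp_all
  have G_obj: "\<And>x. x \<in> Obj D \<Longrightarrow> ?g x \<in> Obj C"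
    and G_hom: "\<And>x y f. \<lbrakk>x \<in> Obj D; y \<in> Obj D; f \<in> Hom D x y\<rbrakk> \<Longrightarrow> ?G x y f \<in> Hom C (?g x) (?g y)"
    and G_Id: "\<And>x. x \<in> Obj D \<Longrightarrow> ?G x x (Id D x) = Id C (?g x)"
    and G_comp: "\<And>x y z f g. \<lbrakk>x \<in> Obj D; y \<in> Obj D; z \<in> Obj D; f \<in> Hom D x y; g \<in> Hom D y z\<rbrakk>
      \<Longrightarrow> ?G x z (Comp D x y z g f) = Comp C (?g x) (?g y) (?g z) (?G y z g) (?G x y f)"
    using G unfolding is_functor_def by simp_all
  note G_simps = G_obj G_hom G_Id G_comp
  have faithful: "f = f'" if "x \<in> Obj D" "y \<in> Obj D" "f \<in> Hom D x y" "f' \<in> Hom D x y"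
    "?G x y f = ?G x y f'" for x y f f'
    using ff[OF that(1,2)] that(3-5) by (meson bij_betw_imp_inj_on inj_onD)
  define L where "L x y = inv_into (Hom D x y) (?G x y)" for x y
  have L_hom: "L x y h \<in> Hom D x y" and G_L: "?G x y (L x y h) = h"
    if "x \<in> Obj D" "y \<in> Obj D" "h \<in> Hom C (?g x) (?g y)" for x y h
    using ff[OF that(1,2)] that(3) unfolding L_def
    by (metis bij_betw_imp_surj_on inv_into_into, metis bij_betw_inv_into_right)
  have "\<forall>c\<in>Obj C. \<exists>d u v. d \<in> Obj D \<and> u \<in> Hom C c (?g d) \<and> v \<in> Hom C (?g d) c \<and>
      Comp C c (?g d) c v u = Id C c \<and> Comp C (?g d) c (?g d) u v = Id C (?g d)"
    using es unfolding is_iso_def by meson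
  then obtain F u v where F: "\<And>c. c \<in> Obj C \<Longrightarrow> F c \<in> Obj D"
    and u: "\<And>c. c \<in> Obj C \<Longrightarrow> u c \<in> Hom C c (?g (F c))"
    and v: "\<And>c. c \<in> Obj C \<Longrightarrow> v c \<in> Hom C (?g (F c)) c"
    and vu: "\<And>c. c \<in> Obj C \<Longrightarrow> Comp C c (?g (F c)) c (v c) (u c) = Id C c"
    and uv: "\<And>c. c \<in> Obj C \<Longrightarrow> Comp C (?g (F c)) c (?g (F c)) (u c) (v c) = Id C (?g (F c))"
    by metis
  \<comment> \<open>\<open>C_assoc\<close> nests composites to the right, so an adjacent pair
    \<open>v\<close>, \<open>u\<close> also has to cancel when a further arrow \<open>h\<close>
    follows inside.\<close>
  have vu': "Comp C w (?g (F c)) c (v c) (Comp C w c (?g (F c)) (u c) h) = h"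
    if "w \<in> Obj C" "c \<in> Obj C" "h \<in> Hom C w c" for w c h
    using C_assoc[of w c "?g (F c)" c h "u c" "v c"] that F u v vu by (simp add: G_obj C_left)
  define k where "k x y f = Comp C (?g (F x)) y (?g (F y)) (u y) (Comp C (?g (F x)) x y f (v x))"
    for x y f
  have k: "k x y f \<in> Hom C (?g (F x)) (?g (F y))"
    if "x \<in> Obj C" "y \<in> Obj C" "f \<in> Hom C x y" for x y f
    unfolding k_def using that by (simp add: C_comp F u v G_obj)
  note simps = F u v vu uv vu' k L_hom G_L D_Id D_comp C_simps G_simps
  define FF where "FF = \<lparr>FObj = F, FHom = (\<lambda>x y f. L (F x) (F y) (k x y f))\<rparr>"
  have FF_simps: "FObj FF = F" "\<And>x y f. FHom FF x y f = L (F x) (F y) (k x y f)"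
    by (simp_all add: FF_def)
  have "is_functor C D FF"
    unfolding is_functor_def FF_simps
  proof (intro conjI ballI)
    fix x assume x: "x \<in> Obj C"
    show "L (F x) (F x) (k x x (Id C x)) = Id D (F x)"
      by (rule faithful[of "F x" "F x"]) (use x in \<open>simp_all add: simps k_def[of x x "Id C x"]\<close>)
  next
    fix x y z f g assume *: "x \<in> Obj C" "y \<in> Obj C" "z \<in> Obj C" "f \<in> Hom C x y" "g \<in> Hom C y z"
    then have "k x z (Comp C x y z g f) = Comp C (?g (F x)) (?g (F y)) (?g (F z)) (k y z g) (k x y f)"
      unfolding k_def by (simp add: simps)
    with * show "L (F x) (F z) (k x z (Comp C x y z g f)) =
        Comp D (F x) (F y) (F z) (L (F y) (F z) (k y z g)) (L (F x) (F y) (k x y f))"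
      by (intro faithful[of "F x" "F z"]) (simp_all add: simps)
  qed (simp_all add: simps)
  moreover have "natural_iso C C id_functor (comp_functor G FF) u"
    unfolding natural_iso_def id_functor_def comp_functor_def
  proof (simp add: FF_simps, intro conjI ballI)
    fix x assume "x \<in> Obj C"
    then show "is_iso C x (?g (F x)) (u x)"
      unfolding is_iso_def using u v uv vu by blast
  next
    fix x y f assume *: "x \<in> Obj C" "y \<in> Obj C" "f \<in> Hom C x y"
    then show "Comp C x y (?g (F y)) (u y) f =
        Comp C x (?g (F x)) (?g (F y)) (?G (F x) (F y) (L (F x) (F y) (k x y f))) (u x)"
      by (simp add: simps) (simp add: k_def simps)
  qed
  \<comment> \<open>\<open>v (?g d)\<close> goes from \<open>?g (F (?g d))\<close> to
    \<open>?g d\<close>, both in the image of \<open>G\<close>, so fullness lifts it to an arrow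
    from \<open>F (?g d)\<close> to \<open>d\<close>.\<close>
  moreover have "natural_iso D D (comp_functor FF G) id_functor (\<lambda>d. L (F (?g d)) d (v (?g d)))"
    unfolding natural_iso_def id_functor_def comp_functor_def
  proof (simp add: FF_simps, intro conjI ballI)
    fix d assume d: "d \<in> Obj D"
    show "is_iso D (F (?g d)) d (L (F (?g d)) d (v (?g d)))"
      unfolding is_iso_def
    proof (intro conjI bexI[of _ "L d (F (?g d)) (u (?g d))"])
      show "Comp D (F (?g d)) d (F (?g d)) (L d (F (?g d)) (u (?g d))) (L (F (?g d)) d (v (?g d)))
          = Id D (F (?g d))"
        by (rule faithful[of "F (?g d)" "F (?g d)"]) (use d in \<open>simp_all add: simps\<close>)
      show "Comp D d (F (?g d)) d (L (F (?g d)) d (v (?g d))) (L d (F (?g d)) (u (?g d))) = Id D d"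
        by (rule faithful[of d d]) (use d in \<open>simp_all add: simps\<close>)
    qed (use d in \<open>simp_all add: simps\<close>)
  next
    fix x y f assume *: "x \<in> Obj D" "y \<in> Obj D" "f \<in> Hom D x y"
    then have "Comp C (?g (F (?g x))) (?g (F (?g y))) (?g y) (v (?g y)) (k (?g x) (?g y) (?G x y f))
        = Comp C (?g (F (?g x))) (?g x) (?g y) (?G x y f) (v (?g x))"
      unfolding k_def by (simp add: simps)
    with * show "Comp D (F (?g x)) (F (?g y)) y (L (F (?g y)) y (v (?g y)))
          (L (F (?g x)) (F (?g y)) (k (?g x) (?g y) (?G x y f))) =
        Comp D (F (?g x)) x y f (L (F (?g x)) x (v (?g x)))"
      by (intro faithful[of "F (?g x)" y]) (simp_all add: simps)
  qed
  ultimately show ?thesis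
    unfolding equivalent_categories_def using C D G by blast
qed

lemma is_category_opposite:
  assumes "is_category C" shows "is_category (opposite C)"
  using assms unfolding is_category_def opposite_def by simp

lemma is_iso_opposite: "is_iso (opposite C) x y f \<longleftrightarrow> is_iso C y x f"
  unfolding is_iso_def opposite_def by auto


section \<open>Ultrafilters and clans\<close>

lemma clanI:
  assumes "\<Gamma> \<subseteq> carr A" "one A \<in> \<Gamma>" "zer A \<notin> \<Gamma>"
    and "\<And>a b. \<lbrakk>a \<in> \<Gamma>; b \<in> carr A; ble A a b\<rbrakk> \<Longrightarrow> b \<in> \<Gamma>"
    and "\<And>a b. \<lbrakk>a \<in> carr A; b \<in> carr A; join A a b \<in> \<Gamma>\<rbrakk> \<Longrightarrow> a \<in> \<Gamma> \<or> b \<in> \<Gamma>"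
    and "\<And>a b. \<lbrakk>a \<in> \<Gamma>; b \<in> \<Gamma>\<rbrakk> \<Longrightarrow> C a b"
  shows "clan A C \<Gamma>"
  unfolding clan_def by (intro conjI ballI impI; rule assms)

lemma clanD:
  assumes "clan A C \<Gamma>"
  shows "\<Gamma> \<subseteq> carr A" "one A \<in> \<Gamma>" "zer A \<notin> \<Gamma>"
    "\<And>a b. \<lbrakk>a \<in> \<Gamma>; b \<in> carr A; ble A a b\<rbrakk> \<Longrightarrow> b \<in> \<Gamma>"
    "\<And>a b. \<lbrakk>a \<in> carr A; b \<in> carr A; join A a b \<in> \<Gamma>\<rbrakk> \<Longrightarrow> a \<in> \<Gamma> \<or> b \<in> \<Gamma>"
    "\<And>a b. \<lbrakk>a \<in> \<Gamma>; b \<in> \<Gamma>\<rbrakk> \<Longrightarrow> C a b"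
  using assms unfolding clan_def by blast+

section \<open>Arithmetic of a Boolean algebra on a carrier\<close>

locale carrier_bool_alg =
  fixes A :: "('a, 'z) bool_alg_scheme"
  assumes bool_alg: "is_bool_alg A"
begin

abbreviation join_op (infixl \<open>\<squnion>\<close> 65) where "a \<squnion> b \<equiv> join A a b"
abbreviation meet_op (infixl \<open>\<sqinter>\<close> 70) where "a \<sqinter> b \<equiv> meet A a b"
abbreviation le_op (infix \<open>\<sqsubseteq>\<close> 50) where "a \<sqsubseteq> b \<equiv> ble A a b"

lemma zero_closed [simp]: "zer A \<in> carr A" and one_closed [simp]: "one A \<in> carr A"
  using bool_alg unfolding is_bool_alg_def by simp_all

lemma cmpl_closed [simp]: "a \<in> carr A \<Longrightarrow> cmpl A a \<in> carr A"
  using bool_alg unfolding is_bool_alg_def by simp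

lemma join_closed [simp]: "\<lbrakk>a \<in> carr A; b \<in> carr A\<rbrakk> \<Longrightarrow> a \<squnion> b \<in> carr A"
  and meet_closed [simp]: "\<lbrakk>a \<in> carr A; b \<in> carr A\<rbrakk> \<Longrightarrow> a \<sqinter> b \<in> carr A"
  using bool_alg unfolding is_bool_alg_def by simp_all

lemma join_comm: "\<lbrakk>a \<in> carr A; b \<in> carr A\<rbrakk> \<Longrightarrow> a \<squnion> b = b \<squnion> a"
  and meet_comm: "\<lbrakk>a \<in> carr A; b \<in> carr A\<rbrakk> \<Longrightarrow> a \<sqinter> b = b \<sqinter> a"
  using bool_alg unfolding is_bool_alg_def by simp_all

lemma join_assoc: "\<lbrakk>a \<in> carr A; b \<in> carr A; c \<in> carr A\<rbrakk> \<Longrightarrow> a \<squnion> b \<squnion> c = a \<squnion> (b \<squnion> c)"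
  and meet_assoc: "\<lbrakk>a \<in> carr A; b \<in> carr A; c \<in> carr A\<rbrakk> \<Longrightarrow> a \<sqinter> b \<sqinter> c = a \<sqinter> (b \<sqinter> c)"
  and meet_join_distrib:
    "\<lbrakk>a \<in> carr A; b \<in> carr A; c \<in> carr A\<rbrakk> \<Longrightarrow> a \<sqinter> (b \<squnion> c) = a \<sqinter> b \<squnion> a \<sqinter> c"
  and join_meet_distrib:
    "\<lbrakk>a \<in> carr A; b \<in> carr A; c \<in> carr A\<rbrakk> \<Longrightarrow> a \<squnion> b \<sqinter> c = (a \<squnion> b) \<sqinter> (a \<squnion> c)"
  using bool_alg unfolding is_bool_alg_def by blast+

lemma join_zero [simp]: "a \<in> carr A \<Longrightarrow> a \<squnion> zer A = a"
  and meet_one [simp]: "a \<in> carr A \<Longrightarrow> a \<sqinter> one A = a"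
  and join_cmpl [simp]: "a \<in> carr A \<Longrightarrow> a \<squnion> cmpl A a = one A"
  and meet_cmpl [simp]: "a \<in> carr A \<Longrightarrow> a \<sqinter> cmpl A a = zer A"
  using bool_alg unfolding is_bool_alg_def by blast+

lemma cmpl_join [simp]: "a \<in> carr A \<Longrightarrow> cmpl A a \<squnion> a = one A"
  and cmpl_meet [simp]: "a \<in> carr A \<Longrightarrow> cmpl A a \<sqinter> a = zer A"
  by (simp_all add: join_comm[of "cmpl A a"] meet_comm[of "cmpl A a"])

lemma meet_idem [simp]: "a \<in> carr A \<Longrightarrow> a \<sqinter> a = a"
  using meet_join_distrib[of a a "cmpl A a"] by simp

lemma join_idem [simp]: "a \<in> carr A \<Longrightarrow> a \<squnion> a = a"
  using join_meet_distrib[of a a "cmpl A a"] by simp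

lemma meet_zero [simp]: "a \<in> carr A \<Longrightarrow> a \<sqinter> zer A = zer A"
  using meet_assoc[of a a "cmpl A a"] by simp

lemma join_one [simp]: "a \<in> carr A \<Longrightarrow> a \<squnion> one A = one A"
  using join_assoc[of a a "cmpl A a"] by simp

lemma zero_join [simp]: "a \<in> carr A \<Longrightarrow> zer A \<squnion> a = a"
  and one_meet [simp]: "a \<in> carr A \<Longrightarrow> one A \<sqinter> a = a"
  and zero_meet [simp]: "a \<in> carr A \<Longrightarrow> zer A \<sqinter> a = zer A"
  by (simp_all add: join_comm[of "zer A"] meet_comm[of "zer A"] meet_comm[of "one A"])

lemma meet_join_absorb: "\<lbrakk>a \<in> carr A; b \<in> carr A\<rbrakk> \<Longrightarrow> a \<sqinter> (a \<squnion> b) = a"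
  using join_meet_distrib[of a "zer A" b] by simp

lemma le_refl [simp]: "a \<in> carr A \<Longrightarrow> a \<sqsubseteq> a"
  by (simp add: ble_def)

lemma le_trans: "\<lbrakk>a \<in> carr A; b \<in> carr A; c \<in> carr A; a \<sqsubseteq> b; b \<sqsubseteq> c\<rbrakk> \<Longrightarrow> a \<sqsubseteq> c"
  unfolding ble_def by (metis meet_assoc)

lemma le_antisym: "\<lbrakk>a \<in> carr A; b \<in> carr A; a \<sqsubseteq> b; b \<sqsubseteq> a\<rbrakk> \<Longrightarrow> a = b"
  unfolding ble_def by (metis meet_comm)

lemma le_one [simp]: "a \<in> carr A \<Longrightarrow> a \<sqsubseteq> one A"
  by (simp add: ble_def)

lemma le_join1 [simp]: "\<lbrakk>a \<in> carr A; b \<in> carr A\<rbrakk> \<Longrightarrow> a \<sqsubseteq> a \<squnion> b"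
  by (simp add: ble_def meet_join_absorb)

lemma le_join2 [simp]: "\<lbrakk>a \<in> carr A; b \<in> carr A\<rbrakk> \<Longrightarrow> b \<sqsubseteq> a \<squnion> b"
  by (metis join_comm le_join1)

lemma meet_le1 [simp]: "\<lbrakk>a \<in> carr A; b \<in> carr A\<rbrakk> \<Longrightarrow> a \<sqinter> b \<sqsubseteq> a"
  unfolding ble_def by (metis meet_assoc meet_comm meet_idem)

lemma meet_le2 [simp]: "\<lbrakk>a \<in> carr A; b \<in> carr A\<rbrakk> \<Longrightarrow> a \<sqinter> b \<sqsubseteq> b"
  by (metis meet_comm meet_le1)

lemma le_meetI: "\<lbrakk>a \<in> carr A; b \<in> carr A; c \<in> carr A; c \<sqsubseteq> a; c \<sqsubseteq> b\<rbrakk> \<Longrightarrow> c \<sqsubseteq> a \<sqinter> b"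
  unfolding ble_def by (metis meet_assoc)

lemma meet_mono:
  assumes "a \<in> carr A" "b \<in> carr A" "c \<in> carr A" "d \<in> carr A" "a \<sqsubseteq> c" "b \<sqsubseteq> d"
  shows "a \<sqinter> b \<sqsubseteq> c \<sqinter> d"
  using assms le_trans[of "a \<sqinter> b" a c] le_trans[of "a \<sqinter> b" b d] by (intro le_meetI) simp_all

lemma cmpl_le_of_join_eq_one:
  assumes "a \<in> carr A" "b \<in> carr A" "a \<squnion> b = one A"
  shows "cmpl A a \<sqsubseteq> b"
  unfolding ble_def using assms meet_join_distrib[of "cmpl A a" a b] by simp

lemma le_cmpl_of_meet_eq_zero:
  assumes "a \<in> carr A" "b \<in> carr A" "a \<sqinter> b = zer A"
  shows "a \<sqsubseteq> cmpl A b"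
  unfolding ble_def using assms meet_join_distrib[of a b "cmpl A b"] by simp

lemma cmpl_eqI:
  assumes "a \<in> carr A" "b \<in> carr A" "a \<squnion> b = one A" "a \<sqinter> b = zer A"
  shows "cmpl A b = a"
  using assms
  by (intro le_antisym le_cmpl_of_meet_eq_zero cmpl_le_of_join_eq_one) (simp_all add: join_comm)

lemma cmpl_cmpl [simp]: "a \<in> carr A \<Longrightarrow> cmpl A (cmpl A a) = a"
  by (rule cmpl_eqI) simp_all

lemma le_of_meet_cmpl_eq_zero:
  "\<lbrakk>a \<in> carr A; b \<in> carr A; a \<sqinter> cmpl A b = zer A\<rbrakk> \<Longrightarrow> a \<sqsubseteq> b"
  using le_cmpl_of_meet_eq_zero[of a "cmpl A b"] by simp

text \<open>De Morgan's law in the shape in which it is met later: the interior of an intersection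
  of two regular closed sets is the complement of a join of complements.\<close>

lemma cmpl_join_cmpl:
  assumes a: "a \<in> carr A" and b: "b \<in> carr A"
  shows "cmpl A (cmpl A a \<squnion> cmpl A b) = a \<sqinter> b"
proof (rule cmpl_eqI)
  have "(cmpl A a \<squnion> cmpl A b) \<squnion> a = one A"
    using a b by (metis cmpl_closed cmpl_join join_assoc join_comm join_one)
  moreover have "(cmpl A a \<squnion> cmpl A b) \<squnion> b = one A"
    using a b by (simp add: join_assoc)
  ultimately show "a \<sqinter> b \<squnion> (cmpl A a \<squnion> cmpl A b) = one A"
    using a b by (simp add: join_comm[of "a \<sqinter> b"] join_meet_distrib)
  have "(a \<sqinter> b) \<sqinter> cmpl A a = zer A"
    using a b by (metis cmpl_closed meet_assoc meet_cmpl meet_comm meet_zero)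
  moreover have "(a \<sqinter> b) \<sqinter> cmpl A b = zer A"
    using a b by (simp add: meet_assoc)
  ultimately show "a \<sqinter> b \<sqinter> (cmpl A a \<squnion> cmpl A b) = zer A"
    using a b by (simp add: meet_join_distrib)
qed (use a b in simp_all)

section \<open>Filters, ultrafilters and their existence inside grills\<close>

definition proper_filter :: "'a set \<Rightarrow> bool" where
  "proper_filter F \<longleftrightarrow> F \<subseteq> carr A \<and> one A \<in> F \<and> zer A \<notin> F \<and>
     (\<forall>a\<in>F. \<forall>b\<in>carr A. a \<sqsubseteq> b \<longrightarrow> b \<in> F) \<and> (\<forall>a\<in>F. \<forall>b\<in>F. a \<sqinter> b \<in> F)"

lemma proper_filterI:
  assumes "F \<subseteq> carr A" "one A \<in> F" "zer A \<notin> F"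
    and "\<And>a b. \<lbrakk>a \<in> F; b \<in> carr A; a \<sqsubseteq> b\<rbrakk> \<Longrightarrow> b \<in> F"
    and "\<And>a b. \<lbrakk>a \<in> F; b \<in> F\<rbrakk> \<Longrightarrow> a \<sqinter> b \<in> F"
  shows "proper_filter F"
  unfolding proper_filter_def by (intro conjI ballI impI; rule assms)

text \<open>These are the ultrafilters; primeness is stated through complements, and its form for
  joins is \<open>prime_filter_join\<close>.\<close>

definition prime_filter :: "'a set \<Rightarrow> bool" where
  "prime_filter U \<longleftrightarrow> proper_filter U \<and> (\<forall>a\<in>carr A. a \<in> U \<or> cmpl A a \<in> U)"

lemma prime_filterD:
  assumes "prime_filter U"
  shows "U \<subseteq> carr A" "one A \<in> U" "zer A \<notin> U"
    "\<And>a b. \<lbrakk>a \<in> U; b \<in> carr A; a \<sqsubseteq> b\<rbrakk> \<Longrightarrow> b \<in> U"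
    "\<And>a b. \<lbrakk>a \<in> U; b \<in> U\<rbrakk> \<Longrightarrow> a \<sqinter> b \<in> U"
    "\<And>a. a \<in> carr A \<Longrightarrow> a \<in> U \<or> cmpl A a \<in> U"
  using assms unfolding prime_filter_def proper_filter_def by blast+

text \<open>\<open>F'\<close> is the filter generated by \<open>F\<close> and \<open>x\<close>. The
  assumption on the meets \<open>p \<sqinter> x\<close> is exactly what keeps zero out of
  it.\<close>

lemma proper_filter_extend:
  assumes F: "proper_filter F" and x: "x \<in> carr A" and nz: "\<And>p. p \<in> F \<Longrightarrow> p \<sqinter> x \<noteq> zer A"
  defines "F' \<equiv> {z \<in> carr A. \<exists>p\<in>F. p \<sqinter> x \<sqsubseteq> z}"
  shows "proper_filter F'" "F \<subseteq> F'" "x \<in> F'"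
proof -
  have sub: "F \<subseteq> carr A" and one: "one A \<in> F" using F unfolding proper_filter_def by auto
  show "F \<subseteq> F'" using sub meet_le1[OF _ x] unfolding F'_def by blast
  show "x \<in> F'" using x one unfolding F'_def by (auto intro: bexI[of _ "one A"])
  have "F' \<subseteq> carr A" unfolding F'_def by blast
  moreover have "one A \<in> F'" using x one sub unfolding F'_def by (auto intro!: bexI[of _ "one A"])
  moreover have "zer A \<notin> F'"
  proof
    assume "zer A \<in> F'"
    then obtain p where "p \<in> F" "p \<sqinter> x \<sqsubseteq> zer A" unfolding F'_def by blast
    then show False using nz[of p] sub x by (auto simp: ble_def)
  qed
  moreover have "b \<in> F'" if "a \<in> F'" "b \<in> carr A" "a \<sqsubseteq> b" for a b
  proof -
    from that obtain p where p: "p \<in> F" "p \<sqinter> x \<sqsubseteq> a" "a \<in> carr A" unfolding F'_def by blast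
    then have "p \<sqinter> x \<sqsubseteq> b" using that sub x le_trans[of "p \<sqinter> x" a b] by auto
    then show ?thesis using that p unfolding F'_def by blast
  qed
  moreover have "a \<sqinter> b \<in> F'" if "a \<in> F'" "b \<in> F'" for a b
  proof -
    from that obtain p q where pq: "p \<in> F" "q \<in> F" "p \<sqinter> x \<sqsubseteq> a" "q \<sqinter> x \<sqsubseteq> b"
      and ab: "a \<in> carr A" "b \<in> carr A" unfolding F'_def by blast
    have p: "p \<in> carr A" and q: "q \<in> carr A" using pq sub by auto
    have "p \<sqinter> q \<sqinter> x \<sqsubseteq> p \<sqinter> x" "p \<sqinter> q \<sqinter> x \<sqsubseteq> q \<sqinter> x"
      using p q x by (simp_all add: meet_mono)
    then have "p \<sqinter> q \<sqinter> x \<sqsubseteq> a \<sqinter> b"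
      using p q x ab pq(3,4) le_trans[of "p \<sqinter> q \<sqinter> x" "p \<sqinter> x" a]
        le_trans[of "p \<sqinter> q \<sqinter> x" "q \<sqinter> x" b] by (intro le_meetI) simp_all
    moreover have "p \<sqinter> q \<in> F" using F pq unfolding proper_filter_def by blast
    ultimately show ?thesis using ab unfolding F'_def by auto
  qed
  ultimately show "proper_filter F'" by (rule proper_filterI)
qed

text \<open>A maximal filter among those consisting of elements of a grill is an ultrafilter: if neither
  \<open>x\<close> nor its complement could be added, the filter would contain elements \<open>p\<close>, \<open>q\<close> with
  \<open>p \<sqinter> x\<close> and \<open>q \<sqinter> cmpl A x\<close> outside the grill.\<close>

lemma prime_filter_in_grill:
  assumes up: "\<And>x y. \<lbrakk>x \<in> carr A; y \<in> carr A; P x; x \<sqsubseteq> y\<rbrakk> \<Longrightarrow> P y"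
    and zero: "\<not> P (zer A)"
    and prime: "\<And>x y. \<lbrakk>x \<in> carr A; y \<in> carr A; P (x \<squnion> y)\<rbrakk> \<Longrightarrow> P x \<or> P y"
    and a: "a \<in> carr A" "P a"
  obtains U where "prime_filter U" "a \<in> U" "\<And>x. x \<in> U \<Longrightarrow> P x"
proof -
  let ?\<F> = "{F. proper_filter F \<and> a \<in> F \<and> (\<forall>x\<in>F. P x)}"
  have up_a: "P y" if "y \<in> carr A" "a \<sqsubseteq> y" for y
    using up[of a y] that a by blast
  have "proper_filter {x \<in> carr A. a \<sqsubseteq> x}"
    unfolding proper_filter_def using a up_a zero
    by (auto intro: le_trans[of a] le_meetI)
  then have "{x \<in> carr A. a \<sqsubseteq> x} \<in> ?\<F>"
    using a up_a by simp
  then have "?\<F> \<noteq> {}" by blast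
  then have "\<exists>U\<in>?\<F>. \<forall>F\<in>?\<F>. U \<subseteq> F \<longrightarrow> F = U"
  proof (rule subset_Zorn_nonempty)
    fix \<C> assume ne: "\<C> \<noteq> {}" and ch: "subset.chain ?\<F> \<C>"
    have mem: "proper_filter F" "a \<in> F" "\<forall>x\<in>F. P x" if "F \<in> \<C>" for F
      using ch that unfolding subset.chain_def by auto
    have "x \<sqinter> y \<in> \<Union>\<C>" if "x \<in> F" "y \<in> F'" "F \<in> \<C>" "F' \<in> \<C>" for x y F F'
    proof -
      have "F \<subseteq> F' \<or> F' \<subseteq> F" using ch that unfolding subset_chain_def by blast
      then show ?thesis using that mem(1)[of F] mem(1)[of F'] unfolding proper_filter_def by blast
    qed
    moreover have "\<Union>\<C> \<subseteq> carr A" "one A \<in> \<Union>\<C>" "zer A \<notin> \<Union>\<C>"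
      "\<forall>x\<in>\<Union>\<C>. \<forall>y\<in>carr A. x \<sqsubseteq> y \<longrightarrow> y \<in> \<Union>\<C>"
      using mem(1) ne unfolding proper_filter_def by blast+
    ultimately have "proper_filter (\<Union>\<C>)"
      unfolding proper_filter_def by blast
    then show "\<Union>\<C> \<in> ?\<F>" using mem ne by blast
  qed
  then obtain U where U_mem: "U \<in> ?\<F>" and U_max: "\<forall>F\<in>?\<F>. U \<subseteq> F \<longrightarrow> F = U" ..
  have U: "proper_filter U" "a \<in> U" "\<forall>x\<in>U. P x" using U_mem by simp_all
  have max: "F = U" if "proper_filter F" "a \<in> F" "\<forall>x\<in>F. P x" "U \<subseteq> F" for F
    using U_max[rule_format, of F] that by simp
  have sub: "U \<subseteq> carr A" using U unfolding proper_filter_def by blast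
  have ex: "\<exists>p\<in>U. \<not> P (p \<sqinter> x)" if x: "x \<in> carr A" "x \<notin> U" for x
  proof (rule ccontr)
    assume "\<not> ?thesis"
    then have all: "\<And>p. p \<in> U \<Longrightarrow> P (p \<sqinter> x)" by blast
    let ?F = "{z \<in> carr A. \<exists>p\<in>U. p \<sqinter> x \<sqsubseteq> z}"
    have nz: "\<And>p. p \<in> U \<Longrightarrow> p \<sqinter> x \<noteq> zer A" using all zero by metis
    note ext = proper_filter_extend[OF U(1) x(1) nz]
    have "\<forall>z\<in>?F. P z" using all up sub x by (blast intro: meet_closed)
    then have "?F = U" using max[of ?F] ext U(2) by blast
    then show False using ext(3) x by simp
  qed
  have "x \<in> U \<or> cmpl A x \<in> U" if x: "x \<in> carr A" for x
  proof (rule ccontr)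
    assume "\<not> ?thesis"
    then obtain p q where p: "p \<in> U" "\<not> P (p \<sqinter> x)" and q: "q \<in> U" "\<not> P (q \<sqinter> cmpl A x)"
      using ex[of x] ex[of "cmpl A x"] x by auto
    have pq: "p \<in> carr A" "q \<in> carr A" using p q sub by auto
    have "p \<sqinter> q \<in> U" using p q U(1) unfolding proper_filter_def by blast
    \<comment> \<open>The element \<open>p \<sqinter> q\<close> of the filter is split along
      \<open>x\<close>. One half would satisfy \<open>P\<close>, but the halves lie below
      \<open>p \<sqinter> x\<close> and \<open>q \<sqinter> cmpl A x\<close>, which do not.\<close>
    then have "P ((p \<sqinter> q) \<sqinter> x \<squnion> (p \<sqinter> q) \<sqinter> cmpl A x)"
      using U(3) x pq by (simp flip: meet_join_distrib)
    then have "P (p \<sqinter> q \<sqinter> x) \<or> P (p \<sqinter> q \<sqinter> cmpl A x)" using prime x pq by simp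
    moreover have "p \<sqinter> q \<sqinter> x \<sqsubseteq> p \<sqinter> x" "p \<sqinter> q \<sqinter> cmpl A x \<sqsubseteq> q \<sqinter> cmpl A x"
      using pq x by (simp_all add: meet_mono)
    ultimately show False using p(2) q(2) up x pq by (meson cmpl_closed meet_closed)
  qed
  then have "prime_filter U" unfolding prime_filter_def using U(1) by blast
  then show thesis using that U by blast
qed

text \<open>Stone separation: the nonzero elements form a grill, and
  \<open>a \<sqinter> cmpl A b\<close> belongs to it.\<close>

lemma prime_filter_of_not_le:
  assumes "a \<in> carr A" "b \<in> carr A" "\<not> a \<sqsubseteq> b"
  obtains U where "prime_filter U" "a \<in> U" "b \<notin> U"
proof -
  obtain U where U: "prime_filter U" "a \<sqinter> cmpl A b \<in> U"
  proof (rule prime_filter_in_grill[of "\<lambda>x. x \<noteq> zer A" "a \<sqinter> cmpl A b"])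
    show "a \<sqinter> cmpl A b \<noteq> zer A" using assms le_of_meet_cmpl_eq_zero by blast
    show "y \<noteq> zer A" if "x \<in> carr A" "y \<in> carr A" "x \<noteq> zer A" "x \<sqsubseteq> y" for x y
      using that by (auto simp: ble_def)
  qed (use assms in auto)
  have "a \<in> U" "cmpl A b \<in> U"
    using prime_filterD(4)[OF U] assms by auto
  moreover from this have "b \<notin> U"
    using prime_filterD(3)[OF U(1)] prime_filterD(5)[OF U(1), of b "cmpl A b"] assms by auto
  ultimately show thesis using that U(1) by blast
qed

lemma prime_filter_join:
  assumes U: "prime_filter U" and ab: "a \<in> carr A" "b \<in> carr A" "a \<squnion> b \<in> U"
  shows "a \<in> U \<or> b \<in> U"
proof (rule ccontr)
  assume *: "\<not> ?thesis"
  then have "cmpl A a \<in> U" using prime_filterD(6)[OF U] ab by blast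
  then have "cmpl A a \<sqinter> (a \<squnion> b) \<in> U" using prime_filterD(5)[OF U] ab by blast
  moreover have "cmpl A a \<sqinter> (a \<squnion> b) \<sqsubseteq> b" using ab by (simp add: meet_join_distrib)
  ultimately show False using * prime_filterD(4)[OF U] ab by blast
qed

text \<open>Grothendieck-style separation: first enlarge \<open>a\<close> to an ultrafilter inside the grill of
  elements related to \<open>b\<close>, then \<open>b\<close> inside the grill of elements related to all of that
  ultrafilter.\<close>

lemma precontact_prime_filters:
  assumes C: "precontact A C" and ab: "a \<in> carr A" "b \<in> carr A" "C a b"
  obtains U V where "prime_filter U" "prime_filter V" "a \<in> U" "b \<in> V"
    "\<And>x y. \<lbrakk>x \<in> U; y \<in> V\<rbrakk> \<Longrightarrow> C x y"
proof -
  have mono: "\<And>x y x' y'. \<lbrakk>C x y; x \<in> carr A; y \<in> carr A; x' \<in> carr A; y' \<in> carr A;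
      x \<sqsubseteq> x'; y \<sqsubseteq> y'\<rbrakk> \<Longrightarrow> C x' y'"
    and zero: "\<And>x y. \<lbrakk>C x y; x \<in> carr A; y \<in> carr A\<rbrakk> \<Longrightarrow> x \<noteq> zer A \<and> y \<noteq> zer A"
    and join_left: "\<And>x y z. \<lbrakk>x \<in> carr A; y \<in> carr A; z \<in> carr A; C (x \<squnion> y) z\<rbrakk> \<Longrightarrow> C x z \<or> C y z"
    and join_right: "\<And>x y z. \<lbrakk>x \<in> carr A; y \<in> carr A; z \<in> carr A; C x (y \<squnion> z)\<rbrakk> \<Longrightarrow> C x y \<or> C x z"
    using C unfolding precontact_def by blast+
  obtain U where U: "prime_filter U" "a \<in> U" "\<And>x. x \<in> U \<Longrightarrow> C x b"
  proof (rule prime_filter_in_grill[of "\<lambda>x. C x b" a])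
    show "C y b" if "x \<in> carr A" "y \<in> carr A" "C x b" "x \<sqsubseteq> y" for x y
      using mono[of x b y b] that ab by simp
    show "\<not> C (zer A) b" using zero[of "zer A" b] ab by auto
  qed (use ab join_left in auto)
  note U_sub = subsetD[OF prime_filterD(1)[OF U(1)]]
  obtain V where V: "prime_filter V" "b \<in> V" "\<And>y. y \<in> V \<Longrightarrow> \<forall>x\<in>U. C x y"
  proof (rule prime_filter_in_grill[of "\<lambda>y. \<forall>x\<in>U. C x y" b])
    show "\<forall>x\<in>U. C x z" if "y \<in> carr A" "z \<in> carr A" "\<forall>x\<in>U. C x y" "y \<sqsubseteq> z" for y z
      using mono[of _ y _ z] that U_sub le_refl by blast
    show "\<not> (\<forall>x\<in>U. C x (zer A))" using zero[of a "zer A"] U(2) ab by auto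
    show "(\<forall>x\<in>U. C x y) \<or> (\<forall>x\<in>U. C x z)"
      if yz: "y \<in> carr A" "z \<in> carr A" and *: "\<forall>x\<in>U. C x (y \<squnion> z)" for y z
    proof (rule ccontr)
      assume "\<not> ?thesis"
      then obtain p q where pq: "p \<in> U" "q \<in> U" "\<not> C p y" "\<not> C q z" by blast
      \<comment> \<open>The two alternatives may fail at different members of \<open>U\<close>;
        closure of \<open>U\<close> under meets merges the witnesses, and monotonicity of
        \<open>C\<close> passes the surviving alternative back to \<open>p\<close> or
        \<open>q\<close>.\<close>
      have m: "p \<sqinter> q \<in> U" using prime_filterD(5)[OF U(1)] pq by blast
      have c: "p \<in> carr A" "q \<in> carr A" using pq U_sub by auto
      have "C (p \<sqinter> q) y \<or> C (p \<sqinter> q) z" using join_right * m yz U_sub by blast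
      then show False
        using mono[of "p \<sqinter> q" y p y] mono[of "p \<sqinter> q" z q z] pq c yz by auto
    qed
  qed (use ab U(3) in auto)
  show thesis using that U V by blast
qed

section \<open>Clans and clusters obtained from ultrafilters\<close>

text \<open>Two members of an ultrafilter have nonzero meet, hence are related by every contact
  relation. In particular ultrafilters are s-clans, which later makes \<open>Xs\<close> nonempty and
  lets it meet every nonempty regular closed set.\<close>

lemma clan_prime_filter:
  assumes C: "contact A C" and U: "prime_filter U"
  shows "clan A C U"
proof -
  have "C a b" if "a \<in> U" "b \<in> U" for a b
    using C prime_filterD(1,3,5)[OF U] that unfolding contact_def by (metis subsetD)
  then show ?thesis
    using prime_filterD(1-4)[OF U] prime_filter_join[OF U] by (intro clanI)
qed

text \<open>The clan is the union of two related ultrafilters. Pairs inside one of them overlap,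
  mixed pairs are related by construction and symmetry, and being upward closed and prime survives
  unions.\<close>

lemma contact_clan:
  assumes C: "contact A C" and ab: "a \<in> carr A" "b \<in> carr A" "C a b"
  obtains \<Gamma> where "clan A C \<Gamma>" "a \<in> \<Gamma>" "b \<in> \<Gamma>"
proof -
  have "precontact A C" using C unfolding contact_def by blast
  then obtain U V where U: "prime_filter U" and V: "prime_filter V" and UV: "a \<in> U" "b \<in> V"
    and rel: "\<And>x y. \<lbrakk>x \<in> U; y \<in> V\<rbrakk> \<Longrightarrow> C x y"
    using precontact_prime_filters[of C a b] ab by blast
  have sym: "\<And>x y. \<lbrakk>x \<in> carr A; y \<in> carr A; C x y\<rbrakk> \<Longrightarrow> C y x"
    using C unfolding contact_def by blast
  have cU: "clan A C U" and cV: "clan A C V" using clan_prime_filter C U V by auto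
  have "U \<union> V \<subseteq> carr A" "one A \<in> U \<union> V" "zer A \<notin> U \<union> V"
    using clanD(1-3)[OF cU] clanD(1-3)[OF cV] by simp_all
  moreover have "y \<in> U \<union> V" if "x \<in> U \<union> V" "y \<in> carr A" "x \<sqsubseteq> y" for x y
    using that clanD(4)[OF cU, of x y] clanD(4)[OF cV, of x y] by blast
  moreover have "x \<in> U \<union> V \<or> y \<in> U \<union> V" if "x \<in> carr A" "y \<in> carr A" "x \<squnion> y \<in> U \<union> V" for x y
    using that clanD(5)[OF cU, of x y] clanD(5)[OF cV, of x y] by blast
  moreover have "C x y" if "x \<in> U \<union> V" "y \<in> U \<union> V" for x y
    using that clanD(1,6)[OF cU] clanD(1,6)[OF cV] rel sym by (metis UnE subsetD)
  ultimately have "clan A C (U \<union> V)" by (rule clanI)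
  then show thesis using that UV by blast
qed

end

text \<open>Take all elements in contact with every member of an ultrafilter \<open>U\<close>. If
  two of them were not in contact, an interpolating \<open>c\<close> would separate them, but
  \<open>c\<close> or its complement lies in \<open>U\<close>. An element left out misses contact
  with some member of \<open>U\<close>, and \<open>U\<close> is contained in the set, which gives
  the cluster property.\<close>

lemma cluster_exists:
  assumes A: "is_dca A"
  shows "\<exists>\<Gamma>. cluster A \<Gamma>"
proof -
  interpret carrier_bool_alg A using A unfolding is_dca_def by unfold_locales blast
  have C: "contact A (Ct A)"
    and eff: "\<And>a b. \<lbrakk>a \<in> carr A; b \<in> carr A; \<not> Ct A a b\<rbrakk>
      \<Longrightarrow> \<exists>c\<in>carr A. \<not> Ct A a c \<and> \<not> Ct A (cmpl A c) b"
    and ne: "\<not> ble A (one A) (zer A)"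
    using A unfolding is_dca_def ble_def by auto
  have mono: "\<And>x y x' y'. \<lbrakk>Ct A x y; x \<in> carr A; y \<in> carr A; x' \<in> carr A; y' \<in> carr A;
      ble A x x'; ble A y y'\<rbrakk> \<Longrightarrow> Ct A x' y'"
    and zero: "\<And>x y. \<lbrakk>Ct A x y; x \<in> carr A; y \<in> carr A\<rbrakk> \<Longrightarrow> x \<noteq> zer A"
    and join_left: "\<And>x y z. \<lbrakk>x \<in> carr A; y \<in> carr A; z \<in> carr A; Ct A (join A x y) z\<rbrakk>
      \<Longrightarrow> Ct A x z \<or> Ct A y z"
    and sym: "\<And>x y. \<lbrakk>x \<in> carr A; y \<in> carr A; Ct A x y\<rbrakk> \<Longrightarrow> Ct A y x"
    using C unfolding contact_def precontact_def by blast+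
  obtain U where U: "prime_filter U"
    using prime_filter_of_not_le[OF one_closed zero_closed ne] by blast
  note U_sub = subsetD[OF prime_filterD(1)[OF U]]
  have cU: "clan A (Ct A) U" by (rule clan_prime_filter[OF C U])
  define \<Gamma> where "\<Gamma> = {a \<in> carr A. \<forall>b\<in>U. Ct A a b}"
  have U_\<Gamma>: "U \<subseteq> \<Gamma>" using cU U_sub unfolding clan_def \<Gamma>_def by blast
  have "\<Gamma> \<subseteq> carr A" unfolding \<Gamma>_def by blast
  moreover have "one A \<in> \<Gamma>" using U_\<Gamma> prime_filterD(2)[OF U] by blast
  moreover have "zer A \<notin> \<Gamma>" using prime_filterD(2)[OF U] zero[of "zer A" "one A"] unfolding \<Gamma>_def by auto
  moreover have "b \<in> \<Gamma>" if "a \<in> \<Gamma>" "b \<in> carr A" "ble A a b" for a b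
    using that mono U_sub le_refl unfolding \<Gamma>_def by blast
  moreover have "a \<in> \<Gamma> \<or> b \<in> \<Gamma>" if ab: "a \<in> carr A" "b \<in> carr A" "join A a b \<in> \<Gamma>" for a b
  proof (rule ccontr)
    assume "\<not> ?thesis"
    then obtain p q where pq: "p \<in> U" "q \<in> U" "\<not> Ct A a p" "\<not> Ct A b q"
      using ab unfolding \<Gamma>_def by blast
    have m: "meet A p q \<in> U" using prime_filterD(5)[OF U] pq by blast
    have c: "p \<in> carr A" "q \<in> carr A" using pq U_sub by auto
    have "Ct A a (meet A p q) \<or> Ct A b (meet A p q)"
      using ab m c join_left[of a b "meet A p q"] unfolding \<Gamma>_def by auto
    then show False
      using mono[of a "meet A p q" a p] mono[of b "meet A p q" b q] pq c ab by auto
  qed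
  moreover have "Ct A a b" if "a \<in> \<Gamma>" "b \<in> \<Gamma>" for a b
  proof (rule ccontr)
    assume "\<not> ?thesis"
    with that obtain c where c: "c \<in> carr A" "\<not> Ct A a c" "\<not> Ct A (cmpl A c) b"
      using eff[of a b] unfolding \<Gamma>_def by blast
    then show False
      using prime_filterD(6)[OF U c(1)] that sym[of b "cmpl A c"] unfolding \<Gamma>_def by auto
  qed
  ultimately have "clan A (Ct A) \<Gamma>" by (rule clanI)
  moreover have "\<exists>b\<in>\<Gamma>. \<not> Ct A a b" if "a \<in> carr A" "a \<notin> \<Gamma>" for a
    using that U_\<Gamma> unfolding \<Gamma>_def by blast
  ultimately have "cluster A \<Gamma>"
    unfolding cluster_def t_clan_def by blast
  then show ?thesis ..
qed


section \<open>Isomorphisms of dynamic contact algebras\<close>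

lemma bool_homD:
  assumes "bool_hom A B f"
  shows "\<And>a. a \<in> carr A \<Longrightarrow> f a \<in> carr B" "f (zer A) = zer B" "f (one A) = one B"
    "\<And>a. a \<in> carr A \<Longrightarrow> f (cmpl A a) = cmpl B (f a)"
    "\<And>a b. \<lbrakk>a \<in> carr A; b \<in> carr A\<rbrakk> \<Longrightarrow> f (join A a b) = join B (f a) (f b)"
    "\<And>a b. \<lbrakk>a \<in> carr A; b \<in> carr A\<rbrakk> \<Longrightarrow> f (meet A a b) = meet B (f a) (f b)"
  using assms unfolding bool_hom_def by blast+

lemma bool_hom_compose:
  assumes "bool_hom A B f" "bool_hom B C g"
  shows "bool_hom A C (\<lambda>a. g (f a))"
  using assms unfolding bool_hom_def by simp

lemma dca_morphism_compose:
  assumes "dca_morphism A B f" "dca_morphism B C g"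
  shows "dca_morphism A C (\<lambda>a. g (f a))"
  using assms bool_hom_compose[of A B f C g] bool_homD(1)[of A B f] unfolding dca_morphism_def by blast

text \<open>Arrows of the categories are restricted functions, so properties have to pass between a
  map and its restriction. Closure of the carrier under the operations is what lets the homomorphism
  equations transfer.\<close>

lemma dca_morphism_cong:
  assumes "is_bool_alg A" "\<And>a. a \<in> carr A \<Longrightarrow> f a = g a" "dca_morphism A B f"
  shows "dca_morphism A B g"
proof -
  interpret carrier_bool_alg A using assms(1) by unfold_locales
  show ?thesis using assms(2,3) unfolding dca_morphism_def bool_hom_def by simp
qed

lemma dca_morphism_id: "dca_morphism A A (\<lambda>a. a)"
  unfolding dca_morphism_def bool_hom_def by simp

text \<open>A bijective morphism only reflects the relations; the equivalences are what make the
  inverse a morphism too. Unlike \<open>is_iso\<close>, this notion compares algebras over different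
  element types.\<close>

definition dca_iso :: "'a dca \<Rightarrow> 'b dca \<Rightarrow> ('a \<Rightarrow> 'b) \<Rightarrow> bool" where
  "dca_iso A B f \<longleftrightarrow> bij_betw f (carr A) (carr B) \<and> bool_hom A B f \<and>
     (\<forall>a\<in>carr A. \<forall>b\<in>carr A.
        (Cs B (f a) (f b) \<longleftrightarrow> Cs A a b) \<and>
        (Ct B (f a) (f b) \<longleftrightarrow> Ct A a b) \<and>
        (Bp B (f a) (f b) \<longleftrightarrow> Bp A a b))"

lemma dca_iso_morphism: "dca_iso A B f \<Longrightarrow> dca_morphism A B f"
  unfolding dca_iso_def dca_morphism_def by blast

lemma dca_iso_compose:
  assumes "dca_iso A B f" "dca_iso B C g"
  shows "dca_iso A C (\<lambda>a. g (f a))"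
proof -
  have "bij_betw (\<lambda>a. g (f a)) (carr A) (carr C)"
    using assms bij_betw_trans[of f "carr A" "carr B" g] unfolding dca_iso_def comp_def by blast
  moreover have "bool_hom A C (\<lambda>a. g (f a))"
    using assms bool_hom_compose unfolding dca_iso_def by blast
  ultimately show ?thesis
    using assms bool_homD(1)[of A B f] unfolding dca_iso_def by simp
qed

lemma dca_iso_inv:
  assumes A: "is_bool_alg A" and f: "dca_iso A B f"
  shows "dca_iso B A (inv_into (carr A) f)"
proof -
  interpret carrier_bool_alg A using A by unfold_locales
  have bij: "bij_betw f (carr A) (carr B)" and hom: "bool_hom A B f"
    using f unfolding dca_iso_def by auto
  have B: "carr B = f ` carr A" using bij by (simp add: bij_betw_def)
  have inv: "\<And>a. a \<in> carr A \<Longrightarrow> inv_into (carr A) f (f a) = a"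
    using bij by (simp add: bij_betw_def)
  \<comment> \<open>Read from right to left, the homomorphism equations turn operations of
    \<open>B\<close> on images into images of operations of \<open>A\<close>; as
    \<open>carr B\<close> is an image, every claim about \<open>B\<close> reduces to one about
    \<open>A\<close>.\<close>
  note hom' = bool_homD(2-)[OF hom, symmetric]
  have "bool_hom B A (inv_into (carr A) f)"
    unfolding bool_hom_def B by (simp add: hom' inv)
  then show ?thesis
    using f bij_betw_inv_into[OF bij] unfolding dca_iso_def by (simp add: B inv)
qed

lemma dca_iso_is_bool_alg:
  assumes A: "is_bool_alg A" and f: "dca_iso A B f"
  shows "is_bool_alg B"
proof -
  interpret carrier_bool_alg A using A by unfold_locales
  have B: "carr B = f ` carr A" and hom: "bool_hom A B f"
    using f unfolding dca_iso_def bij_betw_def by auto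
  note hom' = bool_homD(2-)[OF hom, symmetric]
  show ?thesis
    unfolding is_bool_alg_def B
    by (simp add: hom', intro conjI ballI)
      (metis join_comm meet_comm join_assoc meet_assoc meet_join_distrib join_meet_distrib)+
qed

lemma dca_iso_ble:
  assumes A: "is_bool_alg A" and f: "dca_iso A B f" and "a \<in> carr A" "b \<in> carr A"
  shows "ble B (f a) (f b) \<longleftrightarrow> ble A a b"
proof -
  interpret carrier_bool_alg A using A by unfold_locales
  have "bool_hom A B f" "inj_on f (carr A)"
    using f unfolding dca_iso_def bij_betw_def by auto
  then show ?thesis
    using assms(3,4) unfolding ble_def by (simp add: bool_homD(6)[symmetric] inj_on_eq_iff)
qed

lemma dca_iso_precontact:
  assumes A: "is_bool_alg A" and f: "dca_iso A B f"
    and CD: "\<And>a b. \<lbrakk>a \<in> carr A; b \<in> carr A\<rbrakk> \<Longrightarrow> D (f a) (f b) \<longleftrightarrow> C a b"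
  shows "precontact B D \<longleftrightarrow> precontact A C" "contact B D \<longleftrightarrow> contact A C"
proof -
  interpret carrier_bool_alg A using A by unfold_locales
  have B: "carr B = f ` carr A" and inj: "inj_on f (carr A)" and hom: "bool_hom A B f"
    using f unfolding dca_iso_def bij_betw_def by auto
  note hom' = bool_homD(2-)[OF hom, symmetric]
  show pre: "precontact B D \<longleftrightarrow> precontact A C"
    unfolding precontact_def B
    by (simp add: hom' CD dca_iso_ble[OF A f] inj_on_eq_iff[OF inj])
  show "contact B D \<longleftrightarrow> contact A C"
    unfolding contact_def pre unfolding B
    by (simp add: hom' CD inj_on_eq_iff[OF inj])
qed

lemma dca_iso_is_dca:
  assumes A: "is_dca A" and f: "dca_iso A B f"
  shows "is_dca B"
proof -
  have ba: "is_bool_alg A" using A unfolding is_dca_def by blast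
  interpret carrier_bool_alg A using ba by unfold_locales
  have B: "carr B = f ` carr A" and inj: "inj_on f (carr A)" and hom: "bool_hom A B f"
    and rel: "\<And>a b. \<lbrakk>a \<in> carr A; b \<in> carr A\<rbrakk> \<Longrightarrow> Cs B (f a) (f b) \<longleftrightarrow> Cs A a b"
      "\<And>a b. \<lbrakk>a \<in> carr A; b \<in> carr A\<rbrakk> \<Longrightarrow> Ct B (f a) (f b) \<longleftrightarrow> Ct A a b"
      "\<And>a b. \<lbrakk>a \<in> carr A; b \<in> carr A\<rbrakk> \<Longrightarrow> Bp B (f a) (f b) \<longleftrightarrow> Bp A a b"
    using f unfolding dca_iso_def bij_betw_def by auto
  note hom' = bool_homD(2-)[OF hom, symmetric]
  have "contact B (Cs B)" "contact B (Ct B)" "precontact B (Bp B)"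
    using A dca_iso_precontact(2)[OF ba f, of "Cs B", OF rel(1)]
      dca_iso_precontact(2)[OF ba f, of "Ct B", OF rel(2)]
      dca_iso_precontact(1)[OF ba f, of "Bp B", OF rel(3)]
    unfolding is_dca_def by simp_all
  moreover have "zer B \<noteq> one B"
    using A unfolding is_dca_def by (simp add: hom' inj_on_eq_iff[OF inj])
  ultimately show ?thesis
    using A dca_iso_is_bool_alg[OF ba f] unfolding is_dca_def B by (simp add: hom' rel)
qed

section \<open>Pulling clans and clusters back along morphisms\<close>

text \<open>Reflection of the relation is the direction needed: members of the preimage have related
  images, hence are related themselves. The relation is left generic so as to cover t-clans and
  s-clans.\<close>

lemma clan_pullback:
  assumes A: "is_bool_alg A" and f: "bool_hom A B f"
    and CD: "\<And>a b. \<lbrakk>a \<in> carr A; b \<in> carr A; D (f a) (f b)\<rbrakk> \<Longrightarrow> C a b"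
    and \<Delta>: "clan B D \<Delta>"
  shows "clan A C {a \<in> carr A. f a \<in> \<Delta>}"
proof -
  interpret carrier_bool_alg A using A by unfold_locales
  have ble: "ble B (f a) (f b)" if "a \<in> carr A" "b \<in> carr A" "ble A a b" for a b
    using that bool_homD(6)[OF f, of a b] by (simp add: ble_def)
  let ?\<Gamma> = "{a \<in> carr A. f a \<in> \<Delta>}"
  have "?\<Gamma> \<subseteq> carr A" "one A \<in> ?\<Gamma>" "zer A \<notin> ?\<Gamma>"
    using clanD(2,3)[OF \<Delta>] bool_homD(2,3)[OF f] by auto
  moreover have "b \<in> ?\<Gamma>" if "a \<in> ?\<Gamma>" "b \<in> carr A" "ble A a b" for a b
    using that clanD(4)[OF \<Delta>, of "f a" "f b"] ble[of a b] bool_homD(1)[OF f] by simp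
  moreover have "a \<in> ?\<Gamma> \<or> b \<in> ?\<Gamma>" if "a \<in> carr A" "b \<in> carr A" "join A a b \<in> ?\<Gamma>" for a b
    using that clanD(5)[OF \<Delta>, of "f a" "f b"] bool_homD(1,5)[OF f] by simp
  moreover have "C a b" if "a \<in> ?\<Gamma>" "b \<in> ?\<Gamma>" for a b
    using that CD clanD(6)[OF \<Delta>] by simp
  ultimately show ?thesis by (rule clanI)
qed

lemma t_clan_pullback:
  assumes "is_bool_alg A" "dca_morphism A B f" "t_clan B \<Delta>"
  shows "t_clan A {a \<in> carr A. f a \<in> \<Delta>}"
  using assms clan_pullback[of A B f "Ct B" "Ct A"] unfolding t_clan_def dca_morphism_def by blast

lemma s_clan_pullback:
  assumes "is_bool_alg A" "dca_morphism A B f" "s_clan B \<Delta>"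
  shows "s_clan A {a \<in> carr A. f a \<in> \<Delta>}"
  using assms clan_pullback[of A B f "Cs B" "Cs A"] unfolding s_clan_def dca_morphism_def by blast

text \<open>The witness of non-contact in \<Delta> must come from an element of \<open>A\<close>,
  and non-contact must be carried back to \<open>A\<close>; an isomorphism provides the surjectivity
  and the preservation of \<open>Ct\<close> used for this.\<close>

lemma cluster_pullback:
  assumes A: "is_bool_alg A" and f: "dca_iso A B f" and \<Delta>: "cluster B \<Delta>"
  shows "cluster A {a \<in> carr A. f a \<in> \<Delta>}"
proof -
  have "\<exists>b\<in>{a \<in> carr A. f a \<in> \<Delta>}. \<not> Ct A a b" if a: "a \<in> carr A" "f a \<notin> \<Delta>" for a
  proof -
    have B: "carr B = f ` carr A" using f unfolding dca_iso_def bij_betw_def by auto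
    obtain d where d: "d \<in> \<Delta>" "\<not> Ct B (f a) d"
      using a \<Delta> B unfolding cluster_def by blast
    moreover have "d \<in> carr B" using \<Delta> d unfolding cluster_def t_clan_def clan_def by blast
    ultimately show ?thesis using a f B unfolding dca_iso_def by auto
  qed
  then show ?thesis
    using t_clan_pullback[OF A dca_iso_morphism[OF f]] \<Delta> unfolding cluster_def by auto
qed

text \<open>Transport of structure along an injection, which brings the algebra of a space over
  \<open>'x\<close> into the type \<open>'a\<close>.\<close>

lemma dca_iso_encode:
  assumes A: "is_bool_alg A" and e: "inj_on e (carr A)"
  shows "\<exists>B. dca_iso A B e"
proof
  interpret carrier_bool_alg A using A by unfold_locales
  let ?d = "inv_into (carr A) e"
  show "dca_iso A \<lparr>carr = e ` carr A, zer = e (zer A), one = e (one A),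
      join = (\<lambda>x y. e (join A (?d x) (?d y))), meet = (\<lambda>x y. e (meet A (?d x) (?d y))),
      cmpl = (\<lambda>x. e (cmpl A (?d x))), Cs = (\<lambda>x y. Cs A (?d x) (?d y)),
      Ct = (\<lambda>x y. Ct A (?d x) (?d y)), Bp = (\<lambda>x y. Bp A (?d x) (?d y))\<rparr> e"
    unfolding dca_iso_def bool_hom_def using e by (simp add: inj_on_imp_bij_betw)
qed


section \<open>The space of t-clans\<close>

text \<open>\<open>e\<close> codes sets of algebra elements as points. Injectivity on the power set
  of the carrier suffices because clans are subsets of the carrier.\<close>

locale clan_space =
  fixes A :: "'a dca" and e :: "'a set \<Rightarrow> 'x"
  assumes dca: "is_dca A" and inj_e: "inj_on e (Pow (carr A))"

sublocale clan_space \<subseteq> carrier_bool_alg A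
  using dca unfolding is_dca_def by unfold_locales blast

context clan_space
begin

definition pts :: "'x set" where "pts = e ` {\<Gamma>. t_clan A \<Gamma>}"

text \<open>The Stone map, with t-clans in place of ultrafilters.\<close>

definition ext :: "'a \<Rightarrow> 'x set" where "ext a = e ` {\<Gamma>. t_clan A \<Gamma> \<and> a \<in> \<Gamma>}"

text \<open>The topology whose closed base consists of the sets \<open>ext a\<close>.\<close>

definition clan_open :: "'x set \<Rightarrow> bool" where
  "clan_open U \<longleftrightarrow> U \<subseteq> pts \<and> (\<forall>x\<in>U. \<exists>a\<in>carr A. x \<notin> ext a \<and> pts - ext a \<subseteq> U)"

definition clan_topology :: "'x topology" where "clan_topology = topology clan_open"

definition clan_dms :: "'x dms" where
  "clan_dms = \<lparr>Xt = clan_topology, Xs = e ` {\<Gamma>. s_clan A \<Gamma>}, TT = e ` {\<Gamma>. cluster A \<Gamma>},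
     prec = (\<lambda>x y. \<exists>\<Gamma> \<Delta>. t_clan A \<Gamma> \<and> t_clan A \<Delta> \<and> x = e \<Gamma> \<and> y = e \<Delta> \<and>
       (\<forall>a\<in>\<Gamma>. \<forall>b\<in>\<Delta>. Bp A a b)),
     MM = ext ` carr A\<rparr>"

lemma contact_Ct: "contact A (Ct A)" and contact_Cs: "contact A (Cs A)"
  and precontact_Bp: "precontact A (Bp A)"
  using dca unfolding is_dca_def by blast+

lemma t_clanD:
  assumes "t_clan A \<Gamma>"
  shows "\<Gamma> \<subseteq> carr A" "one A \<in> \<Gamma>" "zer A \<notin> \<Gamma>"
    "\<And>a b. \<lbrakk>a \<in> \<Gamma>; b \<in> carr A; ble A a b\<rbrakk> \<Longrightarrow> b \<in> \<Gamma>"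
    "\<And>a b. \<lbrakk>a \<in> carr A; b \<in> carr A; join A a b \<in> \<Gamma>\<rbrakk> \<Longrightarrow> a \<in> \<Gamma> \<or> b \<in> \<Gamma>"
    "\<And>a b. \<lbrakk>a \<in> \<Gamma>; b \<in> \<Gamma>\<rbrakk> \<Longrightarrow> Ct A a b"
  using clanD[OF assms[unfolded t_clan_def]] by blast+

lemma s_clan_t_clan: "s_clan A \<Gamma> \<Longrightarrow> t_clan A \<Gamma>"
  using dca unfolding s_clan_def t_clan_def clan_def is_dca_def by (metis subsetD)

lemma cluster_t_clan: "cluster A \<Gamma> \<Longrightarrow> t_clan A \<Gamma>"
  unfolding cluster_def by blast

lemma prime_filter_s_clan: "prime_filter U \<Longrightarrow> s_clan A U"
  unfolding s_clan_def by (rule clan_prime_filter[OF contact_Cs])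

lemma prime_filter_t_clan: "prime_filter U \<Longrightarrow> t_clan A U"
  by (rule s_clan_t_clan[OF prime_filter_s_clan])

lemma e_eq_iff: "\<lbrakk>t_clan A \<Gamma>; t_clan A \<Delta>\<rbrakk> \<Longrightarrow> e \<Gamma> = e \<Delta> \<longleftrightarrow> \<Gamma> = \<Delta>"
  using inj_e t_clanD(1) by (auto simp: inj_on_eq_iff)

lemma e_mem_pts: "t_clan A \<Gamma> \<Longrightarrow> e \<Gamma> \<in> pts"
  unfolding pts_def by blast

lemma ptsE:
  assumes "x \<in> pts" obtains \<Gamma> where "t_clan A \<Gamma>" "x = e \<Gamma>"
  using assms unfolding pts_def by blast

lemma e_mem_ext: "t_clan A \<Gamma> \<Longrightarrow> e \<Gamma> \<in> ext a \<longleftrightarrow> a \<in> \<Gamma>"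
  unfolding ext_def using e_eq_iff by auto

lemma ext_subset_pts: "ext a \<subseteq> pts"
  unfolding ext_def pts_def by blast

lemma pts_eqI:
  assumes "P \<subseteq> pts" "Q \<subseteq> pts" "\<And>\<Gamma>. t_clan A \<Gamma> \<Longrightarrow> e \<Gamma> \<in> P \<longleftrightarrow> e \<Gamma> \<in> Q"
  shows "P = Q"
  using assms unfolding pts_def by blast

lemma ext_zero: "ext (zer A) = {}" and ext_one: "ext (one A) = pts"
  unfolding ext_def pts_def using t_clanD(2,3) by blast+

lemma ext_join:
  assumes "a \<in> carr A" "b \<in> carr A"
  shows "ext (join A a b) = ext a \<union> ext b"
proof (rule pts_eqI)
  fix \<Gamma> assume \<Gamma>: "t_clan A \<Gamma>"
  show "e \<Gamma> \<in> ext (join A a b) \<longleftrightarrow> e \<Gamma> \<in> ext a \<union> ext b"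
    using \<Gamma> t_clanD(4)[OF \<Gamma>, of _ "join A a b"] t_clanD(5)[OF \<Gamma>, of a b] assms
    by (auto simp: e_mem_ext)
qed (use ext_subset_pts in auto)

text \<open>Ultrafilters are t-clans, so Stone separation supplies enough points to read off the
  order.\<close>

lemma ext_subset_iff:
  assumes "a \<in> carr A" "b \<in> carr A"
  shows "ext a \<subseteq> ext b \<longleftrightarrow> ble A a b"
proof
  assume sub: "ext a \<subseteq> ext b"
  show "ble A a b"
  proof (rule ccontr)
    assume "\<not> ble A a b"
    then obtain U where "prime_filter U" "a \<in> U" "b \<notin> U"
      using prime_filter_of_not_le assms by blast
    then show False using sub e_mem_ext prime_filter_t_clan by blast
  qed
next
  assume "ble A a b"
  then show "ext a \<subseteq> ext b"
    unfolding ext_def using t_clanD(4) assms by blast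
qed

section \<open>The topology on clans and its regular closed sets\<close>

lemma openin_clan_topology: "openin clan_topology U \<longleftrightarrow> clan_open U"
proof -
  have "clan_open (U \<inter> V)" if U: "clan_open U" and V: "clan_open V" for U V
  proof -
    have "\<exists>c\<in>carr A. x \<notin> ext c \<and> pts - ext c \<subseteq> U \<inter> V" if x: "x \<in> U" "x \<in> V" for x
    proof -
      obtain a b where "a \<in> carr A" "b \<in> carr A" "x \<notin> ext a" "x \<notin> ext b"
        "pts - ext a \<subseteq> U" "pts - ext b \<subseteq> V"
        using U V x unfolding clan_open_def by meson
      then show ?thesis
        by (intro bexI[of _ "join A a b"]) (auto simp: ext_join)
    qed
    then show ?thesis using U V unfolding clan_open_def by blast
  qed
  moreover have "clan_open (\<Union>\<U>)" if "\<forall>U\<in>\<U>. clan_open U" for \<U>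
    using that unfolding clan_open_def by (meson Union_iff Union_least Union_upper subset_trans)
  ultimately have "istopology clan_open"
    unfolding istopology_def by blast
  then show ?thesis unfolding clan_topology_def by simp
qed

lemma topspace_clan_topology: "topspace clan_topology = pts"
proof
  show "topspace clan_topology \<subseteq> pts"
    using openin_topspace[of clan_topology] unfolding openin_clan_topology clan_open_def by blast
  have "clan_open pts"
    unfolding clan_open_def using ext_zero by (auto intro!: bexI[of _ "zer A"])
  then show "pts \<subseteq> topspace clan_topology"
    using openin_subset openin_clan_topology by blast
qed

lemma closedin_clan_topology:
  "closedin clan_topology C \<longleftrightarrow>
     C \<subseteq> pts \<and> (\<forall>x\<in>pts - C. \<exists>a\<in>carr A. x \<notin> ext a \<and> C \<subseteq> ext a)"
proof -
  have "pts - ext a \<subseteq> pts - C \<longleftrightarrow> C \<subseteq> ext a" if "C \<subseteq> pts" for a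
    using that by blast
  then show ?thesis
    unfolding closedin_def openin_clan_topology topspace_clan_topology clan_open_def by blast
qed

lemma closedin_ext: "a \<in> carr A \<Longrightarrow> closedin clan_topology (ext a)"
  unfolding closedin_clan_topology using ext_subset_pts by blast

text \<open>A clan contains one, hence \<open>a\<close> or its complement, possibly both; this is
  why \<open>ext (cmpl A a)\<close> may exceed the set complement. It is nevertheless the closure: a
  basic closed set \<open>ext b\<close> covering the set complement forces
  \<open>join A a b = one A\<close>, so \<open>cmpl A a\<close> lies below \<open>b\<close>.\<close>

lemma closure_of_compl_ext:
  assumes a: "a \<in> carr A"
  shows "clan_topology closure_of (pts - ext a) = ext (cmpl A a)"
proof (rule closure_of_unique)
  have "cmpl A a \<in> \<Gamma>" if "t_clan A \<Gamma>" "a \<notin> \<Gamma>" for \<Gamma>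
    using t_clanD(2,5)[OF that(1)] that(2) a by (metis cmpl_closed join_cmpl)
  then show "pts - ext a \<subseteq> ext (cmpl A a)"
    by (auto elim!: ptsE simp: e_mem_ext)
  show "closedin clan_topology (ext (cmpl A a))"
    using a by (simp add: closedin_ext)
next
  fix C assume C: "pts - ext a \<subseteq> C" "closedin clan_topology C"
  show "ext (cmpl A a) \<subseteq> C"
  proof
    fix x assume x: "x \<in> ext (cmpl A a)"
    show "x \<in> C"
    proof (rule ccontr)
      assume "x \<notin> C"
      then obtain b where b: "b \<in> carr A" "x \<notin> ext b" "C \<subseteq> ext b"
        using C(2) x ext_subset_pts unfolding closedin_clan_topology by blast
      then have "ext (one A) \<subseteq> ext (join A a b)"
        using a C(1) by (auto simp: ext_join ext_one)
      then have "ble A (one A) (join A a b)"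
        using a b by (simp add: ext_subset_iff)
      then have "join A a b = one A"
        using a b by (simp add: ble_def)
      then have "ext (cmpl A a) \<subseteq> ext b"
        using a b by (simp add: ext_subset_iff cmpl_le_of_join_eq_one)
      then show False using x b by blast
    qed
  qed
qed

lemma interior_of_ext:
  "a \<in> carr A \<Longrightarrow> clan_topology interior_of (ext a) = pts - ext (cmpl A a)"
  by (simp add: interior_of_closure_of topspace_clan_topology closure_of_compl_ext)

lemma rc_cmpl_ext: "a \<in> carr A \<Longrightarrow> rc_cmpl clan_topology (ext a) = ext (cmpl A a)"
  by (simp add: rc_cmpl_def topspace_clan_topology closure_of_compl_ext)

lemma ext_regular_closed: "a \<in> carr A \<Longrightarrow> ext a \<in> regular_closed_sets clan_topology"
  by (simp add: regular_closed_sets_def topspace_clan_topology ext_subset_pts interior_of_ext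
      closure_of_compl_ext)

text \<open>A clan may contain \<open>a\<close> and \<open>b\<close> without their meet, so the
  plain intersection can be too large. Its interior is the complement of the join of complements,
  and the closure formula with De Morgan gives the meet.\<close>

lemma rc_meet_ext:
  assumes ab: "a \<in> carr A" "b \<in> carr A"
  shows "rc_meet clan_topology (ext a) (ext b) = ext (meet A a b)"
proof -
  have "clan_topology interior_of (ext a \<inter> ext b) = pts - ext (join A (cmpl A a) (cmpl A b))"
    using ab by (simp add: interior_of_Int interior_of_ext ext_join) blast
  then show ?thesis
    using ab by (simp add: rc_meet_def closure_of_compl_ext cmpl_join_cmpl)
qed

lemma inj_ext: "inj_on ext (carr A)"
  by (rule inj_onI) (metis ext_subset_iff le_antisym order_refl)

lemma clan_dms_simps [simp]:
  "Xt clan_dms = clan_topology" "MM clan_dms = ext ` carr A"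
  "Xs clan_dms = e ` {\<Gamma>. s_clan A \<Gamma>}" "TT clan_dms = e ` {\<Gamma>. cluster A \<Gamma>}"
  by (simp_all add: clan_dms_def)

lemma prec_clan_dms:
  "\<lbrakk>t_clan A \<Gamma>; t_clan A \<Delta>\<rbrakk> \<Longrightarrow> prec clan_dms (e \<Gamma>) (e \<Delta>) \<longleftrightarrow> (\<forall>a\<in>\<Gamma>. \<forall>b\<in>\<Delta>. Bp A a b)"
  unfolding clan_dms_def by (auto simp: e_eq_iff)

text \<open>For \<open>Cs\<close> and \<open>Ct\<close> the two related ultrafilters are glued to
  one clan, which is the common point; for \<open>Bp\<close> they stay apart as the two points
  related by \<open>prec\<close>. The converse directions are the defining properties of clans and
  of \<open>prec\<close>.\<close>

lemma dca_iso_ext: "dca_iso A (dms_plus clan_dms) ext"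
proof -
  have "bool_hom A (dms_plus clan_dms) ext"
    unfolding bool_hom_def dms_plus_def
    by (simp add: ext_zero ext_one topspace_clan_topology ext_join rc_meet_ext rc_cmpl_ext)
  moreover have "Cs (dms_plus clan_dms) (ext a) (ext b) \<longleftrightarrow> Cs A a b"
    if ab: "a \<in> carr A" "b \<in> carr A" for a b
  proof
    assume "Cs A a b"
    then obtain \<Gamma> where "s_clan A \<Gamma>" "a \<in> \<Gamma>" "b \<in> \<Gamma>"
      using contact_clan[OF contact_Cs ab] unfolding s_clan_def by blast
    then have "e \<Gamma> \<in> ext a \<inter> ext b \<inter> Xs clan_dms"
      by (simp add: e_mem_ext s_clan_t_clan)
    then show "Cs (dms_plus clan_dms) (ext a) (ext b)"
      unfolding dms_plus_def by auto
  next
    assume "Cs (dms_plus clan_dms) (ext a) (ext b)"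
    then obtain \<Gamma> where \<Gamma>: "s_clan A \<Gamma>" "e \<Gamma> \<in> ext a" "e \<Gamma> \<in> ext b"
      unfolding dms_plus_def by auto
    then have "a \<in> \<Gamma>" "b \<in> \<Gamma>" by (simp_all add: e_mem_ext s_clan_t_clan)
    then show "Cs A a b" using \<Gamma>(1) unfolding s_clan_def clan_def by blast
  qed
  moreover have "Ct (dms_plus clan_dms) (ext a) (ext b) \<longleftrightarrow> Ct A a b"
    if ab: "a \<in> carr A" "b \<in> carr A" for a b
  proof
    assume "Ct A a b"
    then obtain \<Gamma> where "t_clan A \<Gamma>" "a \<in> \<Gamma>" "b \<in> \<Gamma>"
      using contact_clan[OF contact_Ct ab] unfolding t_clan_def by blast
    then have "e \<Gamma> \<in> ext a \<inter> ext b" by (simp add: e_mem_ext)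
    then show "Ct (dms_plus clan_dms) (ext a) (ext b)"
      unfolding dms_plus_def by auto
  next
    assume "Ct (dms_plus clan_dms) (ext a) (ext b)"
    then obtain x where x: "x \<in> ext a" "x \<in> ext b"
      unfolding dms_plus_def by auto
    then obtain \<Gamma> where \<Gamma>: "t_clan A \<Gamma>" "x = e \<Gamma>"
      using ptsE ext_subset_pts by (metis subsetD)
    then show "Ct A a b" using x t_clanD(6) by (simp add: e_mem_ext)
  qed
  moreover have "Bp (dms_plus clan_dms) (ext a) (ext b) \<longleftrightarrow> Bp A a b"
    if ab: "a \<in> carr A" "b \<in> carr A" for a b
  proof
    assume "Bp A a b"
    then obtain U V where UV: "t_clan A U" "t_clan A V" "a \<in> U" "b \<in> V"
      "\<And>x y. \<lbrakk>x \<in> U; y \<in> V\<rbrakk> \<Longrightarrow> Bp A x y"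
      using precontact_prime_filters[OF precontact_Bp ab] prime_filter_t_clan by metis
    then have "prec clan_dms (e U) (e V)" "e U \<in> ext a" "e V \<in> ext b"
      by (simp_all add: prec_clan_dms e_mem_ext)
    then show "Bp (dms_plus clan_dms) (ext a) (ext b)"
      unfolding dms_plus_def by auto
  next
    assume "Bp (dms_plus clan_dms) (ext a) (ext b)"
    then obtain x y where xy: "x \<in> ext a" "y \<in> ext b" "prec clan_dms x y"
      unfolding dms_plus_def by auto
    then obtain \<Gamma> \<Delta> where "t_clan A \<Gamma>" "x = e \<Gamma>" "t_clan A \<Delta>" "y = e \<Delta>"
      using ptsE ext_subset_pts by (metis subsetD)
    then show "Bp A a b" using xy by (simp add: prec_clan_dms e_mem_ext)
  qed
  ultimately show ?thesis
    unfolding dca_iso_def by (simp add: inj_ext inj_on_imp_bij_betw dms_plus_def[of clan_dms])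
qed

section \<open>DM-compactness, separation and the space axioms\<close>

lemma rho_clan_dms: "t_clan A \<Gamma> \<Longrightarrow> rho clan_dms (e \<Gamma>) = ext ` \<Gamma>"
  unfolding rho_def using t_clanD(1)[of \<Gamma>] by (auto simp: e_mem_ext)

text \<open>The candidate point for a clan \<Delta> of the dual algebra is the code of its preimage
  under \<open>ext\<close>; one computation serves t-clans, s-clans and clusters.\<close>

lemma clan_dms_plus_pullback:
  assumes "\<Delta> \<subseteq> carr (dms_plus clan_dms)" "t_clan A {a \<in> carr A. ext a \<in> \<Delta>}"
  shows "\<Delta> = rho clan_dms (e {a \<in> carr A. ext a \<in> \<Delta>})"
  using assms(1) unfolding rho_clan_dms[OF assms(2)] dms_plus_def by auto

lemma is_bool_alg_clan_dms: "is_bool_alg (dms_plus clan_dms)"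
  by (rule dca_iso_is_bool_alg[OF bool_alg dca_iso_ext])

text \<open>\<open>rho\<close> at the code of \<Gamma> is the pullback of \<Gamma> along the inverse
  of \<open>ext\<close>, and clusters are stable under pullback along isomorphisms.\<close>

lemma cluster_rho:
  assumes "cluster A \<Gamma>"
  shows "cluster (dms_plus clan_dms) (rho clan_dms (e \<Gamma>))"
proof -
  have "rho clan_dms (e \<Gamma>) = {m \<in> carr (dms_plus clan_dms). inv_into (carr A) ext m \<in> \<Gamma>}"
    unfolding rho_clan_dms[OF cluster_t_clan[OF assms]]
    using t_clanD(1)[OF cluster_t_clan[OF assms]] inj_ext by (auto simp: dms_plus_def)
  then show ?thesis
    using cluster_pullback[OF is_bool_alg_clan_dms dca_iso_inv[OF bool_alg dca_iso_ext] assms]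
    by simp
qed

lemma dm_compact_clan_dms: "dm_compact clan_dms"
proof -
  let ?S = "dms_plus clan_dms"
  let ?\<Gamma> = "\<lambda>\<Delta>. {a \<in> carr A. ext a \<in> \<Delta>}"
  have sub: "\<Delta> \<subseteq> carr ?S" if "t_clan ?S \<Delta> \<or> s_clan ?S \<Delta> \<or> cluster ?S \<Delta>" for \<Delta>
    using that unfolding cluster_def t_clan_def s_clan_def clan_def by blast
  note mor = dca_iso_morphism[OF dca_iso_ext]
  have "\<exists>x\<in>topspace (Xt clan_dms). \<Delta> = rho clan_dms x" if "t_clan ?S \<Delta>" for \<Delta>
  proof -
    have "t_clan A (?\<Gamma> \<Delta>)" using t_clan_pullback[OF bool_alg mor that] .
    then show ?thesis
      using clan_dms_plus_pullback[OF sub] that e_mem_pts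
      by (auto simp: topspace_clan_topology intro!: bexI[of _ "e (?\<Gamma> \<Delta>)"])
  qed
  moreover have "\<exists>x\<in>Xs clan_dms. \<Delta> = rho clan_dms x" if "s_clan ?S \<Delta>" for \<Delta>
  proof -
    have "s_clan A (?\<Gamma> \<Delta>)" using s_clan_pullback[OF bool_alg mor that] .
    then show ?thesis
      using clan_dms_plus_pullback[OF sub s_clan_t_clan] that
      by (auto intro!: bexI[of _ "e (?\<Gamma> \<Delta>)"])
  qed
  moreover have "\<exists>x\<in>TT clan_dms. \<Delta> = rho clan_dms x" if "cluster ?S \<Delta>" for \<Delta>
  proof -
    have "cluster A (?\<Gamma> \<Delta>)" using cluster_pullback[OF bool_alg dca_iso_ext that] .
    then show ?thesis
      using clan_dms_plus_pullback[OF sub cluster_t_clan] that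
      by (auto intro!: bexI[of _ "e (?\<Gamma> \<Delta>)"])
  qed
  ultimately show ?thesis unfolding dm_compact_def by blast
qed

lemma t0_space_clan_dms: "t0_space (Xt clan_dms)"
proof -
  have "\<exists>U. openin clan_topology U \<and> (x \<notin> U \<longleftrightarrow> y \<in> U)"
    if xy: "x \<in> pts" "y \<in> pts" "x \<noteq> y" for x y
  proof -
    obtain \<Gamma> \<Delta> where \<Gamma>: "t_clan A \<Gamma>" "t_clan A \<Delta>" "x = e \<Gamma>" "y = e \<Delta>" "\<Gamma> \<noteq> \<Delta>"
      using xy by (metis ptsE)
    then obtain a where a: "a \<in> carr A" "a \<in> \<Gamma> \<longleftrightarrow> a \<notin> \<Delta>"
      using t_clanD(1) by blast
    have "openin clan_topology (pts - ext a)"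
      using closedin_ext[OF a(1)] topspace_clan_topology unfolding closedin_def by simp
    then show ?thesis
      using \<Gamma> a xy by (intro exI[of _ "pts - ext a"]) (auto simp: e_mem_ext)
  qed
  then show ?thesis unfolding t0_space_def by (simp add: topspace_clan_topology)
qed

lemma is_dms_clan_dms: "is_dms clan_dms"
  unfolding is_dms_def
proof (intro conjI)
  obtain \<Gamma> where \<Gamma>: "cluster A \<Gamma>" using cluster_exists[OF dca] by blast
  then show "TT clan_dms \<noteq> {}" "topspace (Xt clan_dms) \<noteq> {}"
    using e_mem_pts cluster_t_clan by (auto simp: topspace_clan_topology)
  have "\<not> ble A (one A) (zer A)" using dca unfolding is_dca_def ble_def by simp
  then obtain U where "prime_filter U" using prime_filter_of_not_le by (meson one_closed zero_closed)
  then show "Xs clan_dms \<noteq> {}" using prime_filter_s_clan by auto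
  show "Xs clan_dms \<subseteq> topspace (Xt clan_dms)" "TT clan_dms \<subseteq> topspace (Xt clan_dms)"
    using e_mem_pts s_clan_t_clan cluster_t_clan by (auto simp: topspace_clan_topology)
  have "ext (zer A) \<in> ext ` carr A" "ext (one A) \<in> ext ` carr A"
    by (rule imageI, simp)+
  moreover have "ext a \<union> ext b \<in> ext ` carr A" if "a \<in> carr A" "b \<in> carr A" for a b
    using that by (metis ext_join imageI join_closed)
  ultimately show "rc_subalgebra (Xt clan_dms) (MM clan_dms)"
    unfolding rc_subalgebra_def
    by (auto simp: ext_zero ext_one topspace_clan_topology rc_cmpl_ext rc_meet_ext ext_regular_closed)
  show "closed_base (Xt clan_dms) (MM clan_dms)"
    unfolding closed_base_def
  proof (intro conjI allI impI ballI)
    fix C assume C: "closedin (Xt clan_dms) C"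
    show "\<exists>F\<subseteq>MM clan_dms. C = topspace (Xt clan_dms) \<inter> \<Inter>F"
      using C unfolding clan_dms_simps closedin_clan_topology topspace_clan_topology
      by (intro exI[of _ "{m \<in> ext ` carr A. C \<subseteq> m}"]) blast
  qed (auto simp: closedin_ext)
  show "\<forall>m\<in>regular_closed_sets (Xt clan_dms). m \<noteq> {} \<longrightarrow> m \<inter> Xs clan_dms \<noteq> {}"
  proof (intro ballI impI)
    fix m assume m: "m \<in> regular_closed_sets (Xt clan_dms)" "m \<noteq> {}"
    let ?I = "clan_topology interior_of m"
    have cl: "clan_topology closure_of ?I = m" using m unfolding regular_closed_sets_def by simp
    then have "?I \<noteq> {}" using m(2) by (metis closure_of_empty)
    moreover have "clan_open ?I" using openin_interior_of openin_clan_topology by blast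
    ultimately obtain x a where a: "a \<in> carr A" "x \<notin> ext a" "x \<in> pts" "pts - ext a \<subseteq> ?I"
      unfolding clan_open_def by blast
    then have "\<not> ext (one A) \<subseteq> ext a" by (auto simp: ext_one)
    \<comment> \<open>A nonempty basic open set omits some \<open>ext a\<close> with
      \<open>a\<close> different from one, so some ultrafilter omits \<open>a\<close>; being an
      s-clan, it is the required point of \<open>Xs\<close>.\<close>
    then obtain U where U: "prime_filter U" "a \<notin> U"
      using prime_filter_of_not_le[of "one A" a] a(1) ext_subset_iff by (metis one_closed)
    then have "e U \<in> pts - ext a"
      using prime_filter_t_clan e_mem_pts by (simp add: e_mem_ext)
    then have "e U \<in> m" using a(4) interior_of_subset[of clan_topology m] by blast
    then show "m \<inter> Xs clan_dms \<noteq> {}" using prime_filter_s_clan[OF U(1)] by auto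
  qed
  show "is_dca (dms_plus clan_dms)" by (rule dca_iso_is_dca[OF dca dca_iso_ext])
  show "\<forall>x\<in>topspace (Xt clan_dms). \<forall>y\<in>topspace (Xt clan_dms). prec clan_dms x y \<longleftrightarrow>
      (\<forall>a\<in>MM clan_dms. \<forall>b\<in>MM clan_dms. x \<in> a \<and> y \<in> b \<longrightarrow> Bp (dms_plus clan_dms) a b)"
  proof (intro ballI)
    fix x y assume "x \<in> topspace (Xt clan_dms)" "y \<in> topspace (Xt clan_dms)"
    then obtain \<Gamma> \<Delta> where \<Gamma>: "t_clan A \<Gamma>" "t_clan A \<Delta>" "x = e \<Gamma>" "y = e \<Delta>"
      by (auto simp: topspace_clan_topology elim!: ptsE)
    have "Bp (dms_plus clan_dms) (ext a) (ext b) \<longleftrightarrow> Bp A a b" if "a \<in> carr A" "b \<in> carr A" for a b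
      using dca_iso_ext that unfolding dca_iso_def by blast
    then show "prec clan_dms x y \<longleftrightarrow>
      (\<forall>a\<in>MM clan_dms. \<forall>b\<in>MM clan_dms. x \<in> a \<and> y \<in> b \<longrightarrow> Bp (dms_plus clan_dms) a b)"
      using \<Gamma> t_clanD(1)[OF \<Gamma>(1)] t_clanD(1)[OF \<Gamma>(2)]
      by (auto simp: prec_clan_dms e_mem_ext) blast
  qed
  show "\<forall>x\<in>TT clan_dms. cluster (dms_plus clan_dms) (rho clan_dms x)"
    using cluster_rho by simp
qed

end


section \<open>The duality\<close>

lemma dms_plus_simps [simp]:
  "carr (dms_plus S) = MM S" "zer (dms_plus S) = {}" "one (dms_plus S) = topspace (Xt S)"
  "join (dms_plus S) a b = a \<union> b" "meet (dms_plus S) a b = rc_meet (Xt S) a b"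
  "Cs (dms_plus S) a b \<longleftrightarrow> a \<inter> b \<inter> Xs S \<noteq> {}" "Ct (dms_plus S) a b \<longleftrightarrow> a \<inter> b \<noteq> {}"
  "Bp (dms_plus S) a b \<longleftrightarrow> (\<exists>x\<in>a. \<exists>y\<in>b. prec S x y)"
  by (simp_all add: dms_plus_def)

lemma is_dmsD:
  assumes "is_dms S"
  shows "rc_subalgebra (Xt S) (MM S)" "closed_base (Xt S) (MM S)" "Xs S \<subseteq> topspace (Xt S)"
    "is_dca (dms_plus S)" "is_bool_alg (dms_plus S)"
    "\<And>x y. \<lbrakk>x \<in> topspace (Xt S); y \<in> topspace (Xt S)\<rbrakk> \<Longrightarrow>
      prec S x y \<longleftrightarrow> (\<forall>a\<in>MM S. \<forall>b\<in>MM S. x \<in> a \<and> y \<in> b \<longrightarrow> Bp (dms_plus S) a b)"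
proof -
  show "is_bool_alg (dms_plus S)"
    using assms unfolding is_dms_def is_dca_def by blast
qed (use assms in \<open>unfold is_dms_def, blast+\<close>)

lemma MM_closedin: "\<lbrakk>is_dms S; a \<in> MM S\<rbrakk> \<Longrightarrow> closedin (Xt S) a"
  using is_dmsD(2) unfolding closed_base_def by blast

lemma MM_subset: "\<lbrakk>is_dms S; a \<in> MM S\<rbrakk> \<Longrightarrow> a \<subseteq> topspace (Xt S)"
  using MM_closedin closedin_subset by blast

text \<open>The order of the dual algebra is defined by the regularized meet, not by intersection;
  it implies inclusion because \<open>b\<close> is closed and so absorbs the closure.\<close>

lemma ble_dms_plus_subset:
  assumes S: "is_dms S" and b: "b \<in> MM S" and le: "ble (dms_plus S) a b"
  shows "a \<subseteq> b"
proof -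
  have "a = Xt S closure_of (Xt S interior_of (a \<inter> b))"
    using le by (simp add: ble_def rc_meet_def)
  also have "\<dots> \<subseteq> Xt S closure_of b"
    by (rule closure_of_mono) (use interior_of_subset[of "Xt S" "a \<inter> b"] in blast)
  also have "\<dots> = b"
    using MM_closedin[OF S b] by (simp add: closure_of_eq)
  finally show ?thesis .
qed

text \<open>Joins are unions, so primeness is immediate, and upward closure is
  \<open>ble_dms_plus_subset\<close>. The relation is generic: \<open>Ct\<close> is used at every
  point, \<open>Cs\<close> at points of \<open>Xs\<close>, where the point itself is the
  witness.\<close>

lemma clan_rho:
  assumes S: "is_dms S" and x: "x \<in> topspace (Xt S)"
    and C: "\<And>a b. \<lbrakk>x \<in> a; x \<in> b\<rbrakk> \<Longrightarrow> C a b"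
  shows "clan (dms_plus S) C (rho S x)"
proof (rule clanI)
  show "one (dms_plus S) \<in> rho S x"
    using is_dmsD(1)[OF S] x unfolding rc_subalgebra_def rho_def by simp
  show "b \<in> rho S x" if "a \<in> rho S x" "b \<in> carr (dms_plus S)" "ble (dms_plus S) a b" for a b
    using that ble_dms_plus_subset[OF S, of b a] unfolding rho_def by auto
qed (use C in \<open>auto simp: rho_def\<close>)

lemma t_clan_rho: "\<lbrakk>is_dms S; x \<in> topspace (Xt S)\<rbrakk> \<Longrightarrow> t_clan (dms_plus S) (rho S x)"
  unfolding t_clan_def by (rule clan_rho) auto

lemma s_clan_rho: "\<lbrakk>is_dms S; x \<in> Xs S\<rbrakk> \<Longrightarrow> s_clan (dms_plus S) (rho S x)"
  unfolding s_clan_def using is_dmsD(3) by (intro clan_rho) auto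

text \<open>The complement of an open set separating the points is an intersection of members of
  \<open>MM S\<close>, and \<open>x\<close> and \<open>y\<close> lie in the same members.\<close>

lemma rho_inject:
  assumes S: "is_dms S" "t0_space (Xt S)" and xy: "x \<in> topspace (Xt S)" "y \<in> topspace (Xt S)"
    and rho: "rho S x = rho S y"
  shows "x = y"
proof (rule ccontr)
  assume "x \<noteq> y"
  then obtain U where U: "openin (Xt S) U" "x \<notin> U \<longleftrightarrow> y \<in> U"
    using S(2) xy unfolding t0_space_def by blast
  then have "closedin (Xt S) (topspace (Xt S) - U)" by blast
  then obtain F where F: "F \<subseteq> MM S" "topspace (Xt S) - U = topspace (Xt S) \<inter> \<Inter>F"
    using is_dmsD(2)[OF S(1)] unfolding closed_base_def by blast
  have "x \<in> \<Inter>F \<longleftrightarrow> y \<in> \<Inter>F"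
    using rho F(1) unfolding rho_def by blast
  then show False using F(2) U(2) xy by blast
qed

section \<open>Morphisms of spaces and their preimage maps\<close>

lemma dms_morphismD:
  assumes "dms_morphism S1 S2 \<theta>"
  shows "\<theta> \<in> topspace (Xt S1) \<rightarrow> topspace (Xt S2)" "\<And>x. x \<in> Xs S1 \<Longrightarrow> \<theta> x \<in> Xs S2"
    "\<And>x y. \<lbrakk>x \<in> topspace (Xt S1); y \<in> topspace (Xt S1); prec S1 x y\<rbrakk> \<Longrightarrow> prec S2 (\<theta> x) (\<theta> y)"
    "\<And>a. a \<in> MM S2 \<Longrightarrow> dms_preimage S1 \<theta> a \<in> MM S1"
    "bool_hom (dms_plus S2) (dms_plus S1) (dms_preimage S1 \<theta>)"
  using assms unfolding dms_morphism_def by blast+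

text \<open>A point, or pair of points, witnessing a relation between preimages is mapped by
  \<theta> to a witness between the original sets. Preservation of \<open>Xs\<close> and
  \<open>prec\<close> thus becomes reflection of \<open>Cs\<close> and \<open>Bp\<close>.\<close>

lemma dms_morphism_preimage:
  assumes \<theta>: "dms_morphism S1 S2 \<theta>"
  shows "dca_morphism (dms_plus S2) (dms_plus S1) (dms_preimage S1 \<theta>)"
proof -
  have "prec S2 (\<theta> x) (\<theta> y)" if "x \<in> dms_preimage S1 \<theta> a" "y \<in> dms_preimage S1 \<theta> b" "prec S1 x y"
    for x y a b
    using dms_morphismD(3)[OF \<theta>] that unfolding dms_preimage_def by blast
  then show ?thesis
    using dms_morphismD(2,5)[OF \<theta>] unfolding dca_morphism_def
    by (fastforce simp: dms_preimage_def)
qed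

lemma dms_preimage_compose:
  assumes "\<theta> \<in> topspace (Xt S1) \<rightarrow> topspace (Xt S2)"
  shows "dms_preimage S1 (compose (topspace (Xt S1)) \<eta> \<theta>) a =
    dms_preimage S1 \<theta> (dms_preimage S2 \<eta> a)"
  using assms unfolding dms_preimage_def by (auto simp: compose_eq)

lemma dms_preimage_id: "\<lbrakk>is_dms S; a \<in> MM S\<rbrakk> \<Longrightarrow> dms_preimage S (restrict id (topspace (Xt S))) a = a"
  using MM_subset[of S a] unfolding dms_preimage_def by auto

lemma dms_morphism_id:
  assumes S: "is_dms S"
  shows "dms_morphism S S (restrict id (topspace (Xt S)))"
proof -
  have "bool_hom (dms_plus S) (dms_plus S) (dms_preimage S (restrict id (topspace (Xt S))))"
    using dca_morphism_cong[OF is_dmsD(5)[OF S] _ dca_morphism_id, of "dms_preimage S (restrict id (topspace (Xt S)))"]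
    by (simp add: dms_preimage_id[OF S] dca_morphism_def)
  then show ?thesis
    using is_dmsD(3)[OF S] unfolding dms_morphism_def by (auto simp: dms_preimage_id[OF S])
qed

lemma dms_morphism_compose:
  assumes S: "is_dms S1" and \<theta>: "dms_morphism S1 S2 \<theta>" and \<eta>: "dms_morphism S2 S3 \<eta>"
  shows "dms_morphism S1 S3 (compose (topspace (Xt S1)) \<eta> \<theta>)"
proof -
  note pre = dms_preimage_compose[OF dms_morphismD(1)[OF \<theta>], of \<eta>]
  have "compose (topspace (Xt S1)) \<eta> \<theta> x = \<eta> (\<theta> x)" if "x \<in> Xs S1" for x
    using is_dmsD(3)[OF S] that by (auto simp: compose_eq)
  moreover have "bool_hom (dms_plus S3) (dms_plus S1)
      (dms_preimage S1 (compose (topspace (Xt S1)) \<eta> \<theta>))"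
    using bool_hom_compose[OF dms_morphismD(5)[OF \<eta>] dms_morphismD(5)[OF \<theta>]]
    by (simp add: pre[abs_def])
  ultimately show ?thesis
    using dms_morphismD(1-4)[OF \<theta>] dms_morphismD(1-4)[OF \<eta>]
    unfolding dms_morphism_def by (auto simp: pre compose_eq Pi_iff)
qed

lemma dms_morphism_eqI:
  assumes S: "is_dms S2" "t0_space (Xt S2)"
    and \<theta>: "dms_morphism S1 S2 \<theta>" and \<eta>: "dms_morphism S1 S2 \<eta>"
    and ext: "\<theta> \<in> extensional (topspace (Xt S1))" "\<eta> \<in> extensional (topspace (Xt S1))"
    and eq: "\<And>a. a \<in> MM S2 \<Longrightarrow> dms_preimage S1 \<theta> a = dms_preimage S1 \<eta> a"
  shows "\<theta> = \<eta>"
proof (rule extensionalityI[OF ext])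
  fix x assume x: "x \<in> topspace (Xt S1)"
  have "rho S2 (\<theta> x) = rho S2 (\<eta> x)"
    using eq x unfolding rho_def dms_preimage_def by blast
  then show "\<theta> x = \<eta> x"
    using rho_inject[OF S] dms_morphismD(1)[OF \<theta>] dms_morphismD(1)[OF \<eta>] x by blast
qed

text \<open>The point \<open>x\<close> goes to the point representing the t-clan \<open>{a. x \<in> f a}\<close>, which
  DM-compactness provides.\<close>

lemma dms_morphism_of_dca_morphism:
  assumes S1: "is_dms S1" and S2: "is_dms S2" "dm_compact S2"
    and f: "dca_morphism (dms_plus S2) (dms_plus S1) f"
  obtains \<theta> where "\<theta> \<in> extensional (topspace (Xt S1))" "dms_morphism S1 S2 \<theta>"
    "\<And>a. a \<in> MM S2 \<Longrightarrow> dms_preimage S1 \<theta> a = f a"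
proof -
  have hom: "bool_hom (dms_plus S2) (dms_plus S1) f" using f unfolding dca_morphism_def by blast
  have compact: "\<And>\<Gamma>. t_clan (dms_plus S2) \<Gamma> \<Longrightarrow> \<exists>y\<in>topspace (Xt S2). \<Gamma> = rho S2 y"
    "\<And>\<Gamma>. s_clan (dms_plus S2) \<Gamma> \<Longrightarrow> \<exists>y\<in>Xs S2. \<Gamma> = rho S2 y"
    using S2(2) unfolding dm_compact_def by simp_all
  have f_MM: "f a \<in> MM S1" if "a \<in> MM S2" for a using bool_homD(1)[OF hom] that by simp
  have pull: "{a \<in> MM S2. f a \<in> rho S1 x} = {a \<in> MM S2. x \<in> f a}" for x
    using f_MM unfolding rho_def by auto
  have "\<exists>y. y \<in> topspace (Xt S2) \<and> rho S2 y = {a \<in> MM S2. x \<in> f a} \<and> (x \<in> Xs S1 \<longrightarrow> y \<in> Xs S2)"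
    if x: "x \<in> topspace (Xt S1)" for x
  \<comment> \<open>The case split governs the choice of the image: for a point of
    \<open>Xs S1\<close> the set is even an s-clan, so the representing point can be taken in
    \<open>Xs S2\<close>.\<close>
  proof (cases "x \<in> Xs S1")
    case True
    then have "s_clan (dms_plus S2) {a \<in> MM S2. x \<in> f a}"
      using s_clan_pullback[OF is_dmsD(5)[OF S2(1)] f s_clan_rho[OF S1]] by (simp add: pull)
    then obtain y where "y \<in> Xs S2" "{a \<in> MM S2. x \<in> f a} = rho S2 y"
      using compact(2) by blast
    then show ?thesis using is_dmsD(3)[OF S2(1)] by auto
  next
    case False
    have "t_clan (dms_plus S2) {a \<in> MM S2. x \<in> f a}"
      using t_clan_pullback[OF is_dmsD(5)[OF S2(1)] f t_clan_rho[OF S1 x]] by (simp add: pull)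
    then obtain y where "y \<in> topspace (Xt S2)" "{a \<in> MM S2. x \<in> f a} = rho S2 y"
      using compact(1) by blast
    then show ?thesis using False by auto
  qed
  then have "\<exists>\<theta>0. \<forall>x\<in>topspace (Xt S1). \<theta>0 x \<in> topspace (Xt S2) \<and>
      rho S2 (\<theta>0 x) = {a \<in> MM S2. x \<in> f a} \<and> (x \<in> Xs S1 \<longrightarrow> \<theta>0 x \<in> Xs S2)"
    by (intro bchoice ballI)
  then obtain \<theta>0 where \<theta>0: "\<And>x. x \<in> topspace (Xt S1) \<Longrightarrow> \<theta>0 x \<in> topspace (Xt S2)"
    "\<And>x. x \<in> topspace (Xt S1) \<Longrightarrow> rho S2 (\<theta>0 x) = {a \<in> MM S2. x \<in> f a}"
    "\<And>x. \<lbrakk>x \<in> topspace (Xt S1); x \<in> Xs S1\<rbrakk> \<Longrightarrow> \<theta>0 x \<in> Xs S2"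
    by blast
  let ?\<theta> = "restrict \<theta>0 (topspace (Xt S1))"
  have mem: "\<theta>0 x \<in> a \<longleftrightarrow> x \<in> f a" if "x \<in> topspace (Xt S1)" "a \<in> MM S2" for x a
    using \<theta>0(2)[OF that(1)] that(2) unfolding rho_def by blast
  have pre: "dms_preimage S1 ?\<theta> a = f a" if "a \<in> MM S2" for a
    using mem that MM_subset[OF S1 f_MM[OF that]] unfolding dms_preimage_def by auto
  have "dms_morphism S1 S2 ?\<theta>"
    unfolding dms_morphism_def
  proof (intro conjI ballI impI)
    show "?\<theta> ` Xs S1 \<subseteq> Xs S2" using \<theta>0(3) is_dmsD(3)[OF S1] by auto
    show "bool_hom (dms_plus S2) (dms_plus S1) (dms_preimage S1 ?\<theta>)"
      using dca_morphism_cong[OF is_dmsD(5)[OF S2(1)] _ f, of "dms_preimage S1 ?\<theta>"] pre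
      by (simp add: dca_morphism_def)
  next
    fix x y assume xy: "x \<in> topspace (Xt S1)" "y \<in> topspace (Xt S1)" "prec S1 x y"
    \<comment> \<open>In \<open>S2\<close> the relation \<open>prec\<close> is determined by
      \<open>Bp\<close> on \<open>MM S2\<close>. The pair \<open>x\<close>, \<open>y\<close>
      witnesses \<open>Bp\<close> between \<open>f a\<close> and \<open>f b\<close>, and
      \<open>f\<close> reflects it.\<close>
    have "Bp (dms_plus S2) a b" if ab: "a \<in> MM S2" "b \<in> MM S2" "\<theta>0 x \<in> a" "\<theta>0 y \<in> b" for a b
    proof -
      have "Bp (dms_plus S1) (f a) (f b)" using ab xy mem by auto
      then show ?thesis using f ab(1,2) unfolding dca_morphism_def by simp
    qed
    then show "prec S2 (?\<theta> x) (?\<theta> y)"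
      using is_dmsD(6)[OF S2(1)] \<theta>0(1) xy by simp
  qed (use \<theta>0(1) pre f_MM in auto)
  then show thesis using that pre by auto
qed

section \<open>The two categories, sizes and the dual equivalence\<close>

lemma is_category_DCA_cat: "is_category (DCA_cat K :: ('a dca, 'a \<Rightarrow> 'a) category)"
proof -
  have ba: "is_bool_alg A" if "is_dca A" for A :: "'a dca"
    using that unfolding is_dca_def by blast
  have idm: "dca_morphism A A (restrict id (carr A))" if "is_dca A" for A :: "'a dca"
    using dca_morphism_cong[OF ba[OF that] _ dca_morphism_id, of "restrict id (carr A)"] by simp
  have comp: "dca_morphism A C (compose (carr A) g f)"
    if "is_dca A" "dca_morphism A B f" "dca_morphism B C g" for A B C :: "'a dca" and f g
    using dca_morphism_cong[OF ba[OF that(1)] _ dca_morphism_compose[OF that(2,3)]]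
    by (simp add: compose_eq)
  have cl: "f \<in> carr A \<rightarrow> carr B" if "dca_morphism A B f" for A B :: "'a dca" and f
    using that unfolding dca_morphism_def bool_hom_def by blast
  show ?thesis
    unfolding is_category_def DCA_cat_def
    by (auto simp: idm intro: comp)
      (auto simp: compose_def restrict_def extensional_def fun_eq_iff dest!: cl)
qed

lemma is_category_DMS_star_cat: "is_category (DMS_star_cat K :: ('x dms, 'x \<Rightarrow> 'x) category)"
proof -
  have cl: "f \<in> topspace (Xt A) \<rightarrow> topspace (Xt B)" if "dms_morphism A B f"
    for A B :: "'x dms" and f
    using dms_morphismD(1)[OF that] .
  show ?thesis
    unfolding is_category_def DMS_star_cat_def
    by (auto simp: dms_morphism_id intro: dms_morphism_compose)
      (auto simp: compose_def restrict_def extensional_def fun_eq_iff dest!: cl)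
qed

lemma dca_iso_is_iso:
  assumes AB: "A \<in> Obj (DCA_cat K)" "B \<in> Obj (DCA_cat K)" and f: "dca_iso A B f"
  shows "is_iso (DCA_cat K) A B (restrict f (carr A))"
proof -
  have ba: "is_bool_alg A" "is_bool_alg B"
    using AB unfolding DCA_cat_def is_dca_def by auto
  have bij: "bij_betw f (carr A) (carr B)" using f unfolding dca_iso_def by blast
  let ?g = "inv_into (carr A) f"
  have g: "dca_iso B A ?g" by (rule dca_iso_inv[OF ba(1) f])
  have "dca_morphism A B (restrict f (carr A))" "dca_morphism B A (restrict ?g (carr B))"
    using dca_morphism_cong[OF ba(1) _ dca_iso_morphism[OF f]]
      dca_morphism_cong[OF ba(2) _ dca_iso_morphism[OF g]] by simp_all
  moreover have "compose (carr A) (restrict ?g (carr B)) (restrict f (carr A)) = restrict id (carr A)"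
    "compose (carr B) (restrict f (carr A)) (restrict ?g (carr B)) = restrict id (carr B)"
    using bij bij_betw_inv_into[OF bij]
    by (auto simp: compose_def fun_eq_iff bij_betw_def f_inv_into_f)
  ultimately show ?thesis
    unfolding is_iso_def DCA_cat_def by auto
qed

text \<open>Admissibility speaks about sets of type \<open>'k set\<close> only, so \<open>X\<close>
  is first moved into \<open>K\<close>; taking images carries its power set along.\<close>

lemma size_admissible_inj:
  fixes K :: "'k set" and X :: "'b set"
  assumes K: "size_admissible K TYPE('a) TYPE('x)" and X: "X \<prec> K"
  shows "\<exists>e :: 'b \<Rightarrow> 'a. inj_on e X" "\<exists>e :: 'b set \<Rightarrow> 'x. inj_on e (Pow X)"
proof -
  obtain f where f: "inj_on f X" "f ` X \<subseteq> K"
    using lesspoll_imp_lepoll[OF X] unfolding lepoll_def by blast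
  have "f ` X \<prec> K" using X f(1) by simp
  then obtain g :: "'k \<Rightarrow> 'a" and h :: "'k set \<Rightarrow> 'x" where "inj_on g (f ` X)" "inj_on h (Pow (f ` X))"
    using K unfolding size_admissible_def lepoll_def by metis
  moreover have "inj_on (image f) (Pow X)" "image f ` Pow X = Pow (f ` X)"
    using f(1) by (auto simp: inj_on_image_Pow image_Pow_surj)
  ultimately have "inj_on (g \<circ> f) X" "inj_on (h \<circ> image f) (Pow X)"
    using f(1) by (auto intro!: comp_inj_on)
  then show "\<exists>e :: 'b \<Rightarrow> 'a. inj_on e X" "\<exists>e :: 'b set \<Rightarrow> 'x. inj_on e (Pow X)"
    by blast+
qed

lemma dca_iso_lesspoll: "\<lbrakk>dca_iso A B f; carr A \<prec> K\<rbrakk> \<Longrightarrow> carr B \<prec> K"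
  unfolding dca_iso_def by (metis eq_lesspoll_trans eqpoll_def eqpoll_sym)

theorem theorem6p13:
  fixes K :: "'k set"
  assumes "size_admissible K TYPE('a) TYPE('x)"
  shows "dually_equivalent (DCA_cat K :: ('a dca, 'a \<Rightarrow> 'a) category)
                           (DMS_star_cat K :: ('x dms, 'x \<Rightarrow> 'x) category)"
proof -
  let ?C = "DCA_cat K :: ('a dca, 'a \<Rightarrow> 'a) category"
  let ?D = "DMS_star_cat K :: ('x dms, 'x \<Rightarrow> 'x) category"
  have C_Obj: "A \<in> Obj ?C \<longleftrightarrow> is_dca A \<and> carr A \<prec> K" for A
    unfolding DCA_cat_def by simp
  have C_Hom: "f \<in> Hom ?C A B \<longleftrightarrow> f \<in> extensional (carr A) \<and> dca_morphism A B f" for A B f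
    unfolding DCA_cat_def by simp
  have D_Obj: "S \<in> Obj ?D \<longleftrightarrow> is_dms S \<and> t0_space (Xt S) \<and> dm_compact S \<and> MM S \<prec> K" for S
    unfolding DMS_star_cat_def by simp
  have D_Hom: "\<theta> \<in> Hom ?D S1 S2 \<longleftrightarrow> \<theta> \<in> extensional (topspace (Xt S1)) \<and> dms_morphism S1 S2 \<theta>"
    for S1 S2 \<theta>
    unfolding DMS_star_cat_def by simp
  \<comment> \<open>The copies can be chosen independently for each space: conjugation in
    \<open>GH\<close> absorbs the choices.\<close>
  have "\<exists>B :: 'a dca. \<exists>\<phi>. dca_iso (dms_plus S) B \<phi>" if "S \<in> Obj ?D" for S
    using that size_admissible_inj(1)[OF assms, of "MM S"] dca_iso_encode[OF is_dmsD(5), of S]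
    unfolding D_Obj by (metis dms_plus_simps(1))
  then obtain B :: "'x dms \<Rightarrow> 'a dca" and \<phi> where
    \<phi>: "\<And>S. S \<in> Obj ?D \<Longrightarrow> dca_iso (dms_plus S) (B S) (\<phi> S)"
    by metis
  define \<psi> where "\<psi> S = inv_into (MM S) (\<phi> S)" for S
  have \<psi>: "dca_iso (B S) (dms_plus S) (\<psi> S)" if "S \<in> Obj ?D" for S
    using dca_iso_inv[OF is_dmsD(5) \<phi>] that unfolding \<psi>_def D_Obj by simp
  have \<phi>_mem: "\<phi> S a \<in> carr (B S)" and \<psi>\<phi>: "\<psi> S (\<phi> S a) = a" if "S \<in> Obj ?D" "a \<in> MM S" for S a
    using \<phi>[OF that(1)] that(2) unfolding dca_iso_def \<psi>_def bij_betw_def by auto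
  have \<psi>_mem: "\<psi> S b \<in> MM S" and \<phi>\<psi>: "\<phi> S (\<psi> S b) = b" if "S \<in> Obj ?D" "b \<in> carr (B S)" for S b
    using \<phi>[OF that(1)] that(2) unfolding dca_iso_def \<psi>_def bij_betw_def
    by (auto simp: inv_into_into f_inv_into_f)
  have B_Obj: "B S \<in> Obj ?C" if "S \<in> Obj ?D" for S
    using that dca_iso_is_dca[OF is_dmsD(4) \<phi>[OF that]] dca_iso_lesspoll[OF \<phi>[OF that], of K]
    unfolding C_Obj D_Obj by simp
  have B_ba: "is_bool_alg (B S)" if "S \<in> Obj ?D" for S
    using B_Obj[OF that] unfolding C_Obj is_dca_def by blast
  define GH where "GH S1 S2 \<theta> = restrict (\<lambda>b. \<phi> S1 (dms_preimage S1 \<theta> (\<psi> S2 b))) (carr (B S2))"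
    for S1 S2 \<theta>
  have GH_Hom: "GH S1 S2 \<theta> \<in> Hom ?C (B S2) (B S1)"
    if S: "S1 \<in> Obj ?D" "S2 \<in> Obj ?D" and \<theta>: "\<theta> \<in> Hom ?D S1 S2" for S1 S2 \<theta>
  proof -
    have "dca_morphism (dms_plus S2) (dms_plus S1) (dms_preimage S1 \<theta>)"
      using \<theta> dms_morphism_preimage unfolding D_Hom by blast
    then have "dca_morphism (B S2) (B S1) (\<lambda>b. \<phi> S1 (dms_preimage S1 \<theta> (\<psi> S2 b)))"
      using dca_morphism_compose dca_iso_morphism \<phi>[OF S(1)] \<psi>[OF S(2)] by metis
    then have "dca_morphism (B S2) (B S1) (GH S1 S2 \<theta>)"
      by (rule dca_morphism_cong[OF B_ba[OF S(2)], rotated]) (simp add: GH_def)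
    then show ?thesis
      unfolding C_Hom by (simp add: GH_def)
  qed
  define G where "G = \<lparr>FObj = B, FHom = GH\<rparr>"
  have G_simps: "FObj G = B" "FHom G = GH" by (simp_all add: G_def)
  have opp: "Obj (opposite ?C) = Obj ?C" "\<And>A B. Hom (opposite ?C) A B = Hom ?C B A"
    "\<And>A. Id (opposite ?C) A = restrict id (carr A)"
    "\<And>A B C f g. Comp (opposite ?C) A B C g f = compose (carr C) f g"
    "\<And>S. Id ?D S = restrict id (topspace (Xt S))"
    "\<And>S1 S2 S3 \<theta> \<eta>. Comp ?D S1 S2 S3 \<eta> \<theta> = compose (topspace (Xt S1)) \<eta> \<theta>"
    by (simp_all add: opposite_def DCA_cat_def DMS_star_cat_def)
  have "equivalent_categories (opposite ?C) ?D"
  proof (rule full_faithful_ess_surj_equivalent)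
    show "is_category (opposite ?C)" by (rule is_category_opposite[OF is_category_DCA_cat])
    show "is_category ?D" by (rule is_category_DMS_star_cat)
    show "is_functor ?D (opposite ?C) G"
      unfolding is_functor_def G_simps opp
    proof (intro conjI ballI)
      fix S assume S: "S \<in> Obj ?D"
      then show "GH S S (restrict id (topspace (Xt S))) = restrict id (carr (B S))"
        unfolding GH_def using D_Obj \<psi>_mem \<phi>\<psi> by (auto simp: fun_eq_iff dms_preimage_id)
    next
      fix S1 S2 S3 \<theta> \<eta>
      assume S: "S1 \<in> Obj ?D" "S2 \<in> Obj ?D" "S3 \<in> Obj ?D"
        and \<theta>: "\<theta> \<in> Hom ?D S1 S2" and \<eta>: "\<eta> \<in> Hom ?D S2 S3"
      have "dms_preimage S2 \<eta> a \<in> MM S2" if "a \<in> MM S3" for a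
        using dms_morphismD(4) that \<eta> unfolding D_Hom by blast
      moreover have "\<theta> \<in> topspace (Xt S1) \<rightarrow> topspace (Xt S2)"
        using dms_morphismD(1) \<theta> unfolding D_Hom by blast
      ultimately show "GH S1 S3 (compose (topspace (Xt S1)) \<eta> \<theta>) =
          compose (carr (B S3)) (GH S1 S2 \<theta>) (GH S2 S3 \<eta>)"
        unfolding GH_def using S \<psi>_mem \<phi>_mem \<psi>\<phi>
        by (auto simp: fun_eq_iff compose_def[of "carr (B S3)"] dms_preimage_compose)
    qed (simp_all add: B_Obj GH_Hom)
  next
    fix S1 S2 assume S: "S1 \<in> Obj ?D" "S2 \<in> Obj ?D"
    have dms: "is_dms S1" "is_dms S2" "t0_space (Xt S2)" "dm_compact S2"
      using S unfolding D_Obj by auto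
    have "inj_on (GH S1 S2) (Hom ?D S1 S2)"
    proof (rule inj_onI)
      fix \<theta> \<eta> assume *: "\<theta> \<in> Hom ?D S1 S2" "\<eta> \<in> Hom ?D S1 S2" "GH S1 S2 \<theta> = GH S1 S2 \<eta>"
      have "dms_preimage S1 \<theta> a = dms_preimage S1 \<eta> a" if a: "a \<in> MM S2" for a
      proof -
        have "GH S1 S2 \<zeta> (\<phi> S2 a) = \<phi> S1 (dms_preimage S1 \<zeta> a)" for \<zeta>
          unfolding GH_def using \<phi>_mem \<psi>\<phi> S(2) a by simp
        then have "\<phi> S1 (dms_preimage S1 \<theta> a) = \<phi> S1 (dms_preimage S1 \<eta> a)"
          using *(3) by metis
        moreover have "dms_preimage S1 \<theta> a \<in> MM S1" "dms_preimage S1 \<eta> a \<in> MM S1"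
          using * a dms_morphismD(4) unfolding D_Hom by blast+
        ultimately show ?thesis using \<psi>\<phi>[OF S(1)] by metis
      qed
      then show "\<theta> = \<eta>"
        using dms_morphism_eqI[OF dms(2,3)] * unfolding D_Hom by blast
    qed
    moreover have "h \<in> GH S1 S2 ` Hom ?D S1 S2" if h: "h \<in> Hom ?C (B S2) (B S1)" for h
    proof -
      \<comment> \<open>Fullness: undoing the conjugation turns \<open>h\<close> into a morphism
        between the actual dual algebras, which is induced by a map of points.\<close>
      have "dca_morphism (dms_plus S2) (dms_plus S1) (\<lambda>a. \<psi> S1 (h (\<phi> S2 a)))"
        using h dca_morphism_compose dca_iso_morphism \<psi>[OF S(1)] \<phi>[OF S(2)] unfolding C_Hom by metis
      then obtain \<theta> where \<theta>: "\<theta> \<in> extensional (topspace (Xt S1))" "dms_morphism S1 S2 \<theta>"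
        and pre: "\<And>a. a \<in> MM S2 \<Longrightarrow> dms_preimage S1 \<theta> a = \<psi> S1 (h (\<phi> S2 a))"
        using dms_morphism_of_dca_morphism[OF dms(1,2,4)] by blast
      have h': "h \<in> extensional (carr (B S2))" "\<And>b. b \<in> carr (B S2) \<Longrightarrow> h b \<in> carr (B S1)"
        using h bool_homD(1)[of "B S2" "B S1" h] unfolding C_Hom dca_morphism_def by blast+
      have "h = GH S1 S2 \<theta>"
        unfolding GH_def
        by (rule extensionalityI[OF h'(1)]) (simp_all add: pre \<psi>_mem \<phi>\<psi> S h'(2))
      moreover have "\<theta> \<in> Hom ?D S1 S2" using \<theta> unfolding D_Hom by simp
      ultimately show ?thesis by (rule image_eqI)
    qed
    ultimately show "bij_betw (FHom G S1 S2) (Hom ?D S1 S2) (Hom (opposite ?C) (FObj G S1) (FObj G S2))"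
      unfolding G_simps opp bij_betw_def using GH_Hom[OF S] by blast
  next
    fix A assume A: "A \<in> Obj (opposite ?C)"
    then have A': "is_dca A" "carr A \<prec> K" unfolding opp C_Obj by auto
    then obtain e :: "'a set \<Rightarrow> 'x" where "inj_on e (Pow (carr A))"
      using size_admissible_inj(2)[OF assms] by blast
    then interpret clan_space A e using A' by unfold_locales
    have "carr (dms_plus clan_dms) \<prec> K" by (rule dca_iso_lesspoll[OF dca_iso_ext A'(2)])
    then have S: "clan_dms \<in> Obj ?D"
      unfolding D_Obj using is_dms_clan_dms t0_space_clan_dms dm_compact_clan_dms by simp
    \<comment> \<open>\<open>A\<close> is isomorphic to the dual algebra of its clan space through
      \<open>ext\<close>, and that algebra to its chosen copy. The inverse is then used because
      arrows are reversed in the opposite category.\<close>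
    obtain k where "dca_iso A (B clan_dms) k"
      using dca_iso_compose[OF dca_iso_ext \<phi>[OF S]] by blast
    then have "is_iso ?C (B clan_dms) A (restrict (inv_into (carr A) k) (carr (B clan_dms)))"
      using dca_iso_is_iso[OF B_Obj[OF S]] A dca_iso_inv[OF bool_alg] unfolding opp by blast
    then show "\<exists>S\<in>Obj ?D. \<exists>u. is_iso (opposite ?C) A (FObj G S) u"
      using S unfolding is_iso_opposite G_simps by blast
  qed
  then show ?thesis unfolding dually_equivalent_def .
qed

end
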